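(* Let $r\ge0$ be an integer. There is a constant $C_r$ depending only on $r$ such that for every $N\in\mathbb{N}$ the following holds. Let $D_{R_N}\subseteq\mathbb{R}^2$ be the disk centered at the origin of area $N$ (so $R_N=\sqrt{N/\pi}$), let $K_{h_r,D_{R_N}}(z,z')=\sum_{j=1}^N p_j(z)\overline{p_j(z')}$ be the correlation kernel of the finite Weyl-Heisenberg ensemble with window $h_r$ and domain $D_{R_N}$, and let $K'_{r,N}(z,z')=\sum_{j=0}^{N-1}V_{h_r}h_j(z)\overline{V_{h_r}h_j(z')}$. Then $$\big\|K_{h_r,D_{R_N}}-K'_{r,N}\big\|_{S^1}\le C_r\,|\partial D_{R_N}|_1\le C_r'\sqrt N,$$ where $\|\cdot\|_{S^1}$ is the trace norm of the corresponding integral operators on $L^2(\mathbb{R}^2)$ and $C_r'$ depends only on $r$.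
   Context: $z=(x,\xi)\in\mathbb{R}^2$. Phase-space shift $\pi(z)f(t)=e^{2\pi i\xi t}f(t-x)$; $V_gf(z)=\langle f,\pi(z)g\rangle$; $K^g(z,z')=\langle\pi(z')g,\pi(z)g\rangle$. Hermite functions: $h_r(t)=\frac{2^{1/4}}{\sqrt{r!}}\big(\frac{-1}{2\sqrt\pi}\big)^r e^{\pi t^2}\frac{d^r}{dt^r}(e^{-2\pi t^2})$. For $\|g\|_2=1$ and $\Omega$ of finite measure, $M^g_\Omega$ is the integral operator on $L^2(\mathbb{R}^2)$ with kernel $\int K^g(z,z'')1_\Omega(z'')K^g(z'',z')dz''$; write $M^g_\Omega=\sum_{j\ge1}\lambda_jp_j\otimes p_j$ with nonzero eigenvalues $\lambda_1\ge\lambda_2\ge\dots$ counted with multiplicity and $\{p_j\}$ a corresponding orthonormal family of eigenfunctions. The finite Weyl-Heisenberg ensemble kernel is $\sum_{j=1}^{\lceil|\Omega|\rceil}p_j(z)\overline{p_j(z')}$. $|\partial D_R|_1=2\pi R$ is the perimeter. *)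

theory Defs
  imports "HOL-Analysis.Analysis"
begin

type_synonym phase = "real \<times> real"

definition tfshift :: "phase \<Rightarrow> (real \<Rightarrow> complex) \<Rightarrow> real \<Rightarrow> complex" where
  "tfshift z f t = exp (2 * pi * \<i> * complex_of_real (snd z * t)) * f (t - fst z)"

definition stft :: "(real \<Rightarrow> complex) \<Rightarrow> (real \<Rightarrow> complex) \<Rightarrow> phase \<Rightarrow> complex" where
  "stft g f z = (LINT t|lborel. f t * cnj (tfshift z g t))"

definition rkernel :: "(real \<Rightarrow> complex) \<Rightarrow> phase \<Rightarrow> phase \<Rightarrow> complex" where
  "rkernel g z z' = (LINT t|lborel. tfshift z' g t * cnj (tfshift z g t))"

definition hermite :: "nat \<Rightarrow> real \<Rightarrow> complex" where
  "hermite r t = complex_of_real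
     (2 powr (1/4) / sqrt (fact r) * (- 1 / (2 * sqrt pi)) ^ r * exp (pi * t\<^sup>2)
      * (deriv ^^ r) (\<lambda>s. exp (- 2 * pi * s\<^sup>2)) t)"

definition loc_kernel :: "(real \<Rightarrow> complex) \<Rightarrow> phase set \<Rightarrow> phase \<Rightarrow> phase \<Rightarrow> complex" where
  "loc_kernel g \<Omega> z z' = (LINT z''|lborel. rkernel g z z'' * indicator \<Omega> z'' * rkernel g z'' z')"

definition sq_int :: "(phase \<Rightarrow> complex) \<Rightarrow> bool" where
  "sq_int f \<longleftrightarrow> f \<in> borel_measurable lborel \<and> integrable lborel (\<lambda>z. (cmod (f z))\<^sup>2)"

definition l2_inner :: "(phase \<Rightarrow> complex) \<Rightarrow> (phase \<Rightarrow> complex) \<Rightarrow> complex" where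
  "l2_inner f g = (LINT z|lborel. f z * cnj (g z))"

definition kernel_apply :: "(phase \<Rightarrow> phase \<Rightarrow> complex) \<Rightarrow> (phase \<Rightarrow> complex) \<Rightarrow> phase \<Rightarrow> complex" where
  "kernel_apply K f z = (LINT z'|lborel. K z z' * f z')"

definition orthonormal_on :: "nat set \<Rightarrow> (nat \<Rightarrow> phase \<Rightarrow> complex) \<Rightarrow> bool" where
  "orthonormal_on I e \<longleftrightarrow> (\<forall>i\<in>I. sq_int (e i)) \<and>
     (\<forall>i\<in>I. \<forall>j\<in>I. l2_inner (e i) (e j) = (if i = j then 1 else 0))"

definition trace_norm :: "(phase \<Rightarrow> phase \<Rightarrow> complex) \<Rightarrow> ereal" where
  "trace_norm K = (SUP x \<in> {(n, e, f). orthonormal_on {..<n} e \<and> orthonormal_on {..<n} f}.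
      ereal (\<Sum>i<fst x. cmod (l2_inner (kernel_apply K (fst (snd x) i)) (snd (snd x) i))))"

text \<open>M = sum_{j>=1} lam_j p_j (x) p_j: nonzero eigenvalues lam_1 >= lam_2 >= ... counted with
  multiplicity, p_j orthonormal eigenfunctions, and M vanishes on their orthogonal complement.\<close>
definition eigensystem :: "(phase \<Rightarrow> phase \<Rightarrow> complex) \<Rightarrow> (nat \<Rightarrow> real) \<Rightarrow> (nat \<Rightarrow> phase \<Rightarrow> complex) \<Rightarrow> bool" where
  "eigensystem M lam p \<longleftrightarrow>
     orthonormal_on {1..} p \<and>
     (\<forall>j\<ge>1. lam j \<noteq> 0) \<and>
     (\<forall>i\<ge>1. \<forall>j\<ge>i. lam j \<le> lam i) \<and>
     (\<forall>j\<ge>1. AE z in lborel. kernel_apply M (p j) z = complex_of_real (lam j) * p j z) \<and>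
     (\<forall>f. sq_int f \<longrightarrow> (\<forall>j\<ge>1. l2_inner f (p j) = 0) \<longrightarrow>
          (AE z in lborel. kernel_apply M f z = 0))"

definition fwh_kernel :: "phase set \<Rightarrow> (nat \<Rightarrow> phase \<Rightarrow> complex) \<Rightarrow> phase \<Rightarrow> phase \<Rightarrow> complex" where
  "fwh_kernel \<Omega> p z z' = (\<Sum>j=1..nat \<lceil>measure lborel \<Omega>\<rceil>. p j z * cnj (p j z'))"

end

theory Submission
  imports Defs "HOL-Probability.Probability"
begin

text \<open>Write \<open>w\<^sub>k\<close> for the short-time Fourier transform of the \<open>k\<close>-th Hermite function with window
  \<open>h\<^sub>r\<close>. The ladder relations of the Hermite functions give recurrences for the \<open>w\<^sub>k\<close>, from which one reads
  off that they are orthonormal, that the reproducing kernel is \<open>\<Sum> w\<^sub>k(z) cnj (w\<^sub>k(z'))\<close>, and, by rotation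
  covariance, that they stay orthogonal on every centred disk. So the localization operator \<open>M\<close> of the disk is
  diagonal in the \<open>w\<^sub>k\<close> with eigenvalues \<open>\<mu>\<^sub>k = \<integral>\<^sub>D |w\<^sub>k|\<^sup>2\<close> of total sum \<open>N\<close>. Both kernels are orthogonal
  projections of rank \<open>N\<close> commuting with \<open>M\<close>, and a projection of this kind onto eigenfunctions
  with eigenvalues \<open>\<kappa>\<^sub>1, \<dots>, \<kappa>\<^sub>N\<close> has trace distance at most \<open>2 (N - \<Sum> \<kappa>\<^sub>j)\<close> from \<open>M\<close>. As the \<open>\<lambda>\<^sub>j\<close>
  are the largest eigenvalues, everything reduces to \<open>\<Sum>\<^sub>k\<^sub><\<^sub>N (1 - \<mu>\<^sub>k) = O(sqrt N)\<close>. Under the density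
  \<open>|w\<^sub>k|\<^sup>2\<close> the variable \<open>\<pi> |z|\<^sup>2\<close> has mean \<open>k + r + 1\<close> and variance \<open>O(k + 1)\<close>, so Chebyshev's inequality gives
  \<open>1 - \<mu>\<^sub>k = O(N / (N - k - r - 1)\<^sup>2)\<close>, which sums to \<open>O(sqrt N)\<close>.\<close>

subsection \<open>Square-integrable functions on phase space\<close>

text \<open>The detour through \<open>M\<close> is forced by degeneracy: several
  \<open>w\<^sub>k\<close> may share an eigenvalue, the functions \<open>p\<^sub>j\<close> may mix
  them arbitrarily, and the order of the \<open>\<mu>\<^sub>k\<close> is left open. So the two
  families cannot be matched term by term; what survives every choice is that both consist of
  eigenfunctions and that the leading \<open>\<lambda>\<^sub>j\<close> have the larger sum. That the
  area is the integer \<open>N\<close> matters: each projection then has rank equal to the trace of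
  \<open>M\<close>, so the deficit of \<open>M\<close> on the range of the projection and its mass
  off that range are the same number \<open>N - \<Sum> \<kappa>\<^sub>j\<close>. This is the origin
  of the factor 2. The window cannot be kept fixed. Multiplication by the complex coordinate moves
  both the window index and the Hermite index, and the variance involves windows
  \<open>r - 1\<close> and \<open>r + 1\<close>; hence everything about the coefficients is proved
  for two free indices. The \<open>w\<^sub>k\<close> of one window span only part of L2 of phase
  space, so expansions start from the pointwise kernel series and not from completeness.\<close>

definition l2_sq :: "(phase \<Rightarrow> complex) \<Rightarrow> real" where
  "l2_sq f = (LINT z|lborel. (cmod (f z))\<^sup>2)"

lemma borel_measurable_cnj [measurable (raw)]:
  "f \<in> borel_measurable M \<Longrightarrow> (\<lambda>x. cnj (f x)) \<in> borel_measurable M"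
  by (rule measurable_compose[OF _ borel_measurable_continuous_onI[OF continuous_on_cnj]])
     (auto intro: continuous_intros)

lemma sq_int_measurable [measurable_dest]: "sq_int f \<Longrightarrow> f \<in> borel_measurable borel"
  by (simp add: sq_int_def)

lemma sq_int_integrable: "sq_int f \<Longrightarrow> integrable lborel (\<lambda>z. (cmod (f z))\<^sup>2)"
  by (simp add: sq_int_def)

lemma sq_int_integrable_mult:
  assumes "sq_int f" "sq_int g"
  shows "integrable lborel (\<lambda>z. f z * cnj (g z))"
proof (rule Bochner_Integration.integrable_bound)
  show "integrable lborel (\<lambda>z. (cmod (f z))\<^sup>2 + (cmod (g z))\<^sup>2)"
    using assms by (intro Bochner_Integration.integrable_add sq_int_integrable)
  show "(\<lambda>z. f z * cnj (g z)) \<in> borel_measurable lborel"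
    using assms by measurable
  have "a * b \<le> a\<^sup>2 + b\<^sup>2" if "0 \<le> a" "0 \<le> b" for a b :: real
    using sum_squares_bound[of a b] mult_nonneg_nonneg[OF that] by linarith
  then show "AE z in lborel. norm (f z * cnj (g z)) \<le> norm ((cmod (f z))\<^sup>2 + (cmod (g z))\<^sup>2)"
    by (intro AE_I2) (simp add: norm_mult)
qed

lemma sq_int_zero [simp]: "sq_int (\<lambda>z. 0)"
  by (simp add: sq_int_def)

lemma sq_int_cmult [intro]: "sq_int f \<Longrightarrow> sq_int (\<lambda>z. c * f z)"
  by (auto simp: sq_int_def norm_mult power_mult_distrib)

lemma sq_int_bound:
  assumes g: "sq_int g" and f: "f \<in> borel_measurable borel" and "\<And>z. cmod (f z) \<le> cmod (g z)"
  shows "sq_int f"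
  unfolding sq_int_def
proof
  show "f \<in> borel_measurable lborel" using f by simp
  show "integrable lborel (\<lambda>z. (cmod (f z))\<^sup>2)"
    using assms
    by (intro Bochner_Integration.integrable_bound[OF sq_int_integrable[OF g]])
       (auto intro!: power_mono)
qed

lemma sq_int_indicator [intro]:
  assumes "sq_int f" "S \<in> sets borel"
  shows "sq_int (\<lambda>z. indicator S z * f z)"
  using assms by (intro sq_int_bound[OF assms(1)]) (auto simp: indicator_def split: if_splits)

lemma sq_int_add [intro]:
  assumes f: "sq_int f" and g: "sq_int g"
  shows "sq_int (\<lambda>z. f z + g z)"
  unfolding sq_int_def
proof
  show "(\<lambda>z. f z + g z) \<in> borel_measurable lborel" using assms by measurable
  show "integrable lborel (\<lambda>z. (cmod (f z + g z))\<^sup>2)"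
  proof (rule Bochner_Integration.integrable_bound)
    show "integrable lborel (\<lambda>z. 2 * (cmod (f z))\<^sup>2 + 2 * (cmod (g z))\<^sup>2)"
      using assms
      by (intro Bochner_Integration.integrable_add integrable_mult_right sq_int_integrable)
    show "(\<lambda>z. (cmod (f z + g z))\<^sup>2) \<in> borel_measurable lborel" using assms by measurable
    have "(cmod (f z + g z))\<^sup>2 \<le> 2 * (cmod (f z))\<^sup>2 + 2 * (cmod (g z))\<^sup>2" for z
    proof -
      have "(cmod (f z + g z))\<^sup>2 \<le> (cmod (f z) + cmod (g z))\<^sup>2"
        by (intro power_mono norm_triangle_ineq) auto
      also have "\<dots> \<le> 2 * (cmod (f z))\<^sup>2 + 2 * (cmod (g z))\<^sup>2"
        using sum_squares_bound[of "cmod (f z)" "cmod (g z)"] by (simp add: power2_sum)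
      finally show ?thesis .
    qed
    then show "AE z in lborel. norm ((cmod (f z + g z))\<^sup>2) \<le> norm (2 * (cmod (f z))\<^sup>2 + 2 * (cmod (g z))\<^sup>2)"
      by (intro AE_I2) simp
  qed
qed

lemma sq_int_diff [intro]: "sq_int f \<Longrightarrow> sq_int g \<Longrightarrow> sq_int (\<lambda>z. f z - g z)"
  using sq_int_add[of f "\<lambda>z. (- 1) * g z"] sq_int_cmult[of g "- 1"] by simp

lemma sq_int_sum [intro]: "(\<And>i. i \<in> I \<Longrightarrow> sq_int (f i)) \<Longrightarrow> sq_int (\<lambda>z. \<Sum>i\<in>I. f i z)"
  by (induction I rule: infinite_finite_induct) auto

lemma sq_int_lincomb:
  assumes "\<And>i. i \<in> I \<Longrightarrow> sq_int (e i)"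
  shows "sq_int (\<lambda>z. \<Sum>i\<in>I. a i * e i z)"
  by (intro sq_int_sum sq_int_cmult assms)

lemma mult_cnj_self: "c * cnj c = (complex_of_real (cmod c))\<^sup>2"
  using complex_norm_square[of c] by simp

lemma l2_inner_commute: "l2_inner g f = cnj (l2_inner f g)"
proof -
  have "cnj (l2_inner f g) = (LINT z|lborel. cnj (f z * cnj (g z)))"
    unfolding l2_inner_def by (rule Bochner_Integration.integral_cnj[symmetric])
  then show ?thesis by (simp add: l2_inner_def mult.commute)
qed

lemma l2_inner_self: "l2_inner f f = complex_of_real (l2_sq f)"
  unfolding l2_inner_def l2_sq_def integral_complex_of_real[symmetric]
  by (simp add: mult_cnj_self)

lemma l2_sq_nonneg [simp]: "0 \<le> l2_sq f"
  by (simp add: l2_sq_def)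

lemma l2_inner_cmult_left: "l2_inner (\<lambda>z. c * f z) g = c * l2_inner f g"
  by (simp add: l2_inner_def mult.assoc)

lemma l2_inner_add_left:
  "sq_int f \<Longrightarrow> sq_int g \<Longrightarrow> sq_int h \<Longrightarrow> l2_inner (\<lambda>z. f z + g z) h = l2_inner f h + l2_inner g h"
  by (simp add: l2_inner_def distrib_right sq_int_integrable_mult)

lemma l2_inner_diff_left:
  "sq_int f \<Longrightarrow> sq_int g \<Longrightarrow> sq_int h \<Longrightarrow> l2_inner (\<lambda>z. f z - g z) h = l2_inner f h - l2_inner g h"
  by (simp add: l2_inner_def left_diff_distrib sq_int_integrable_mult)

lemma l2_inner_sum_left:
  assumes "\<And>i. i \<in> I \<Longrightarrow> sq_int (f i)" "sq_int h"
  shows "l2_inner (\<lambda>z. \<Sum>i\<in>I. f i z) h = (\<Sum>i\<in>I. l2_inner (f i) h)"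
  unfolding l2_inner_def sum_distrib_right
  using assms by (intro Bochner_Integration.integral_sum sq_int_integrable_mult) auto

lemma l2_inner_cmult_right: "l2_inner f (\<lambda>z. c * g z) = cnj c * l2_inner f g"
  by (simp add: l2_inner_commute[of f] l2_inner_cmult_left)

lemma l2_inner_add_right:
  "sq_int f \<Longrightarrow> sq_int g \<Longrightarrow> sq_int h \<Longrightarrow> l2_inner h (\<lambda>z. f z + g z) = l2_inner h f + l2_inner h g"
  by (simp add: l2_inner_commute[of h] l2_inner_add_left)

lemma l2_inner_diff_right:
  "sq_int f \<Longrightarrow> sq_int g \<Longrightarrow> sq_int h \<Longrightarrow> l2_inner h (\<lambda>z. f z - g z) = l2_inner h f - l2_inner h g"
  by (simp add: l2_inner_commute[of h] l2_inner_diff_left)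

lemma l2_inner_sum_right:
  assumes "\<And>i. i \<in> I \<Longrightarrow> sq_int (f i)" "sq_int h"
  shows "l2_inner h (\<lambda>z. \<Sum>i\<in>I. f i z) = (\<Sum>i\<in>I. l2_inner h (f i))"
  using assms by (simp add: l2_inner_commute[of h] l2_inner_sum_left)

lemma l2_inner_AE_cong_left:
  assumes "AE z in lborel. f z = g z" "sq_int f" "sq_int g" "sq_int h"
  shows "l2_inner f h = l2_inner g h"
  unfolding l2_inner_def using assms
  by (intro integral_cong_AE) auto

lemma l2_inner_le:
  assumes f: "sq_int f" and g: "sq_int g"
  shows "cmod (l2_inner f g) \<le> sqrt (l2_sq f) * sqrt (l2_sq g)"
proof -
  have nn: "(\<integral>\<^sup>+ z. ennreal (cmod (u z)) ^ 2 \<partial>lborel) = ennreal (l2_sq u)" if "sq_int u" for u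
    using sq_int_integrable[OF that] unfolding l2_sq_def
    by (subst nn_integral_eq_integral[symmetric]) (auto simp: ennreal_power)
  have int: "integrable lborel (\<lambda>z. cmod (f z) * cmod (g z))"
    using integrable_norm[OF sq_int_integrable_mult[OF f g]] by (simp add: norm_mult)
  have "(\<integral>\<^sup>+ z. ennreal (cmod (f z)) * ennreal (cmod (g z)) \<partial>lborel)\<^sup>2
     \<le> (\<integral>\<^sup>+ z. ennreal (cmod (f z)) ^ 2 \<partial>lborel) * (\<integral>\<^sup>+ z. ennreal (cmod (g z)) ^ 2 \<partial>lborel)"
    using sq_int_measurable[OF f] sq_int_measurable[OF g] by (intro Cauchy_Schwarz_nn_integral) auto
  also have "\<dots> = ennreal (l2_sq f * l2_sq g)"
    using f g by (simp add: nn ennreal_mult)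
  also have "(\<integral>\<^sup>+ z. ennreal (cmod (f z)) * ennreal (cmod (g z)) \<partial>lborel)
      = ennreal (LINT z|lborel. cmod (f z) * cmod (g z))"
    using int by (subst nn_integral_eq_integral[symmetric]) (auto simp: ennreal_mult)
  finally have "(LINT z|lborel. cmod (f z) * cmod (g z))\<^sup>2 \<le> l2_sq f * l2_sq g"
    by (simp add: ennreal_power)
  then have "(LINT z|lborel. cmod (f z) * cmod (g z)) \<le> sqrt (l2_sq f * l2_sq g)"
    by (rule real_le_rsqrt)
  moreover have "cmod (l2_inner f g) \<le> (LINT z|lborel. cmod (f z) * cmod (g z))"
    unfolding l2_inner_def by (rule order_trans[OF integral_norm_bound]) (simp add: norm_mult)
  ultimately show ?thesis
    by (simp add: real_sqrt_mult)
qed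

section \<open>Orthonormal families, Bessel's inequality and orthogonal series\<close>

lemma orthonormal_onD:
  assumes "orthonormal_on I e"
  shows "i \<in> I \<Longrightarrow> sq_int (e i)"
    and "i \<in> I \<Longrightarrow> j \<in> I \<Longrightarrow> l2_inner (e i) (e j) = (if i = j then 1 else 0)"
  using assms by (auto simp: orthonormal_on_def)

lemma orthonormal_on_subset: "orthonormal_on I e \<Longrightarrow> J \<subseteq> I \<Longrightarrow> orthonormal_on J e"
  unfolding orthonormal_on_def by blast

lemma orthonormal_l2_sq:
  assumes "orthonormal_on I e" "i \<in> I"
  shows "l2_sq (e i) = 1"
  using orthonormal_onD(2)[OF assms assms(2)] l2_inner_self[of "e i"]
  by (metis of_real_eq_1_iff)

lemma l2_inner_lincomb:
  assumes "orthonormal_on J e" "finite J" "j \<in> J"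
  shows "l2_inner (\<lambda>z. \<Sum>i\<in>J. a i * e i z) (e j) = a j"
proof -
  have "l2_inner (\<lambda>z. \<Sum>i\<in>J. a i * e i z) (e j) = (\<Sum>i\<in>J. a i * l2_inner (e i) (e j))"
    using assms by (subst l2_inner_sum_left) (auto simp: l2_inner_cmult_left dest: orthonormal_onD)
  also have "\<dots> = (\<Sum>i\<in>J. if i = j then a i else 0)"
    using assms by (intro sum.cong) (auto dest: orthonormal_onD)
  finally show ?thesis using assms by simp
qed

lemma l2_sq_lincomb:
  assumes "orthonormal_on J e" "finite J"
  shows "l2_sq (\<lambda>z. \<Sum>i\<in>J. a i * e i z) = (\<Sum>i\<in>J. (cmod (a i))\<^sup>2)"
proof -
  let ?s = "\<lambda>z. \<Sum>i\<in>J. a i * e i z"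
  have s: "sq_int ?s" using assms by (intro sq_int_lincomb orthonormal_onD)
  have "complex_of_real (l2_sq ?s) = (\<Sum>j\<in>J. cnj (a j) * l2_inner ?s (e j))"
    unfolding l2_inner_self[symmetric]
    using assms s by (subst l2_inner_sum_right) (auto simp: l2_inner_cmult_right dest: orthonormal_onD)
  also have "\<dots> = (\<Sum>j\<in>J. complex_of_real ((cmod (a j))\<^sup>2))"
    using assms by (intro sum.cong)
      (auto simp: l2_inner_lincomb mult_cnj_self mult.commute[of "cnj _"])
  finally have "complex_of_real (l2_sq ?s) = complex_of_real (\<Sum>j\<in>J. (cmod (a j))\<^sup>2)"
    by simp
  then show ?thesis by (rule of_real_eq_iff[THEN iffD1])
qed

text \<open>Pythagoras for the projection onto a finite span. Kept as an equality because, besides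
  Bessel, it later computes a trace on a complement and detects membership in a span.\<close>

lemma l2_sq_residual:
  assumes "orthonormal_on J e" "finite J" "sq_int f"
  shows "l2_sq (\<lambda>z. f z - (\<Sum>i\<in>J. l2_inner f (e i) * e i z))
     = l2_sq f - (\<Sum>i\<in>J. (cmod (l2_inner f (e i)))\<^sup>2)"
proof -
  let ?s = "\<lambda>z. \<Sum>i\<in>J. l2_inner f (e i) * e i z"
  have e: "sq_int (e i)" if "i \<in> J" for i using assms that by (auto dest: orthonormal_onD)
  have s: "sq_int ?s" by (intro sq_int_lincomb e)
  have fs: "l2_inner f ?s = complex_of_real (\<Sum>i\<in>J. (cmod (l2_inner f (e i)))\<^sup>2)"
    using e assms
    by (subst l2_inner_sum_right)
      (auto simp: l2_inner_cmult_right mult_cnj_self mult.commute[of "cnj _"])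
  have ss: "l2_inner ?s ?s = complex_of_real (\<Sum>i\<in>J. (cmod (l2_inner f (e i)))\<^sup>2)"
    using l2_sq_lincomb[OF assms(1,2)] by (simp add: l2_inner_self)
  have sf: "l2_inner ?s f = complex_of_real (\<Sum>i\<in>J. (cmod (l2_inner f (e i)))\<^sup>2)"
    by (subst l2_inner_commute) (simp add: fs)
  have fs': "sq_int (\<lambda>z. f z - ?s z)" using assms s by (intro sq_int_diff)
  have "complex_of_real (l2_sq (\<lambda>z. f z - ?s z)) = l2_inner (\<lambda>z. f z - ?s z) (\<lambda>z. f z - ?s z)"
    by (simp add: l2_inner_self)
  also have "\<dots> = (l2_inner f f - l2_inner f ?s) - (l2_inner ?s f - l2_inner ?s ?s)"
    using assms s fs' by (simp only: l2_inner_diff_left l2_inner_diff_right)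
  also have "\<dots> = complex_of_real (l2_sq f - (\<Sum>i\<in>J. (cmod (l2_inner f (e i)))\<^sup>2))"
    unfolding fs sf ss by (simp add: l2_inner_self)
  finally show ?thesis by (rule of_real_eq_iff[THEN iffD1])
qed

lemma bessel:
  assumes "orthonormal_on J e" "finite J" "sq_int f"
  shows "(\<Sum>i\<in>J. (cmod (l2_inner f (e i)))\<^sup>2) \<le> l2_sq f"
  using l2_sq_residual[OF assms]
    l2_sq_nonneg[of "\<lambda>z. f z - (\<Sum>i\<in>J. l2_inner f (e i) * e i z)"] by linarith

lemma bessel_summable:
  fixes e :: "nat \<Rightarrow> phase \<Rightarrow> complex"
  assumes "orthonormal_on UNIV e" "sq_int f"
  shows "summable (\<lambda>i. (cmod (l2_inner f (e i)))\<^sup>2)"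
    and "(\<Sum>i. (cmod (l2_inner f (e i)))\<^sup>2) \<le> l2_sq f"
proof -
  have b: "(\<Sum>i<n. (cmod (l2_inner f (e i)))\<^sup>2) \<le> l2_sq f" for n
    using assms by (intro bessel) (auto intro: orthonormal_on_subset)
  show s: "summable (\<lambda>i. (cmod (l2_inner f (e i)))\<^sup>2)"
    using b by (intro bounded_imp_summable[where B = "l2_sq f"])
      (auto simp flip: lessThan_Suc_atMost simp del: sum.lessThan_Suc)
  show "(\<Sum>i. (cmod (l2_inner f (e i)))\<^sup>2) \<le> l2_sq f"
    using b by (intro suminf_le_const s)
qed

text \<open>A Riesz--Fischer statement for series which are already known to converge pointwise;
  Fatou's lemma identifies the pointwise sum with the \<open>L\<^sup>2\<close> limit.\<close>

lemma pointwise_series_l2: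
  fixes e :: "nat \<Rightarrow> phase \<Rightarrow> complex"
  assumes on: "orthonormal_on UNIV e"
    and a: "summable (\<lambda>k. (cmod (a k))\<^sup>2)"
    and F: "\<And>z. (\<lambda>k. a k * e k z) sums F z"
  shows "sq_int F"
    and "sq_int h \<Longrightarrow> (\<lambda>k. a k * l2_inner (e k) h) sums l2_inner F h"
proof -
  define S where "S n z = (\<Sum>k<n. a k * e k z)" for n z
  define T where "T n = (\<Sum>k. (cmod (a (k + n)))\<^sup>2)" for n
  have e: "sq_int (e k)" for k using on by (auto dest: orthonormal_onD)
  have S: "sq_int (S n)" for n unfolding S_def by (intro sq_int_lincomb e)
  have Sm [measurable]: "S n \<in> borel_measurable borel" for n
    by (rule sq_int_measurable[OF S])
  have lim: "(\<lambda>n. S n z) \<longlonglongrightarrow> F z" for z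
    using F[of z] by (simp add: sums_def S_def)
  have Fm [measurable]: "F \<in> borel_measurable borel"
    by (rule borel_measurable_LIMSEQ_metric[OF sq_int_measurable[OF S] lim])
  have tail: "l2_sq (\<lambda>z. S m z - S n z) \<le> T n" if "n \<le> m" for n m
  proof -
    have "S m z - S n z = (\<Sum>k\<in>{n..<m}. a k * e k z)" for z
      unfolding S_def using that sum_diff_nat_ivl[of 0 n m "\<lambda>k. a k * e k z"]
      by (simp add: atLeast0LessThan)
    then have "l2_sq (\<lambda>z. S m z - S n z) = (\<Sum>k\<in>{n..<m}. (cmod (a k))\<^sup>2)"
      using l2_sq_lincomb[of "{n..<m}" e a] orthonormal_on_subset[OF on] by simp
    also have "\<dots> = (\<Sum>k<m - n. (cmod (a (k + n)))\<^sup>2)"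
      using that sum.shift_bounds_nat_ivl[of "\<lambda>k. (cmod (a k))\<^sup>2" 0 n "m - n"]
      by (simp add: atLeast0LessThan)
    also have "\<dots> \<le> T n"
      unfolding T_def by (intro sum_le_suminf) (auto intro: summable_ignore_initial_segment[OF a])
    finally show ?thesis .
  qed
  have fatou: "(\<integral>\<^sup>+ z. ennreal ((cmod (F z - S n z))\<^sup>2) \<partial>lborel) \<le> ennreal (T n)" for n
  proof -
    have "(\<lambda>m. ennreal ((cmod (S m z - S n z))\<^sup>2)) \<longlonglongrightarrow> ennreal ((cmod (F z - S n z))\<^sup>2)" for z
      by (intro tendsto_intros lim)
    then have "ennreal ((cmod (F z - S n z))\<^sup>2) = liminf (\<lambda>m. ennreal ((cmod (S m z - S n z))\<^sup>2))" for z
      by (rule lim_imp_Liminf[OF trivial_limit_sequentially, symmetric])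
    then have "(\<integral>\<^sup>+ z. ennreal ((cmod (F z - S n z))\<^sup>2) \<partial>lborel)
        = (\<integral>\<^sup>+ z. liminf (\<lambda>m. ennreal ((cmod (S m z - S n z))\<^sup>2)) \<partial>lborel)" by simp
    also have "\<dots> \<le> liminf (\<lambda>m. \<integral>\<^sup>+ z. ennreal ((cmod (S m z - S n z))\<^sup>2) \<partial>lborel)"
      by (intro nn_integral_liminf) measurable
    also have "\<dots> \<le> ennreal (T n)"
    proof (rule Liminf_le)
      have "(\<integral>\<^sup>+ z. ennreal ((cmod (S m z - S n z))\<^sup>2) \<partial>lborel) \<le> ennreal (T n)" if "n \<le> m" for m
      proof -
        have "sq_int (\<lambda>z. S m z - S n z)" by (intro sq_int_diff S)
        then have "(\<integral>\<^sup>+ z. ennreal ((cmod (S m z - S n z))\<^sup>2) \<partial>lborel) = ennreal (l2_sq (\<lambda>z. S m z - S n z))"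
          unfolding l2_sq_def by (intro nn_integral_eq_integral) (auto simp: sq_int_integrable)
        then show ?thesis using tail[OF that] by (simp add: ennreal_leI)
      qed
      then show "\<forall>\<^sub>F m in sequentially. (\<integral>\<^sup>+ z. ennreal ((cmod (S m z - S n z))\<^sup>2) \<partial>lborel) \<le> ennreal (T n)"
        unfolding eventually_sequentially by blast
    qed simp
    finally show ?thesis .
  qed
  have FS: "sq_int (\<lambda>z. F z - S n z)" for n
    unfolding sq_int_def
  proof
    show m: "(\<lambda>z. F z - S n z) \<in> borel_measurable lborel" by measurable
    show "integrable lborel (\<lambda>z. (cmod (F z - S n z))\<^sup>2)"
    proof (rule integrableI_bounded)
      show "(\<lambda>z. (cmod (F z - S n z))\<^sup>2) \<in> borel_measurable lborel" by measurable
      have "(\<integral>\<^sup>+ z. ennreal (norm ((cmod (F z - S n z))\<^sup>2)) \<partial>lborel) \<le> ennreal (T n)"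
        using fatou[of n] by simp
      then show "(\<integral>\<^sup>+ z. ennreal (norm ((cmod (F z - S n z))\<^sup>2)) \<partial>lborel) < \<infinity>"
        by (rule le_less_trans) simp
    qed
  qed
  \<comment> \<open>\<open>S 0\<close> is the zero function, so the residual at \<open>n = 0\<close>
    is \<open>F\<close> itself.\<close>
  then show Fsq: "sq_int F" using FS[of 0] by (simp add: S_def)
  have bd: "l2_sq (\<lambda>z. F z - S n z) \<le> T n" for n
  proof -
    have "ennreal (l2_sq (\<lambda>z. F z - S n z)) = (\<integral>\<^sup>+ z. ennreal ((cmod (F z - S n z))\<^sup>2) \<partial>lborel)"
      using FS[of n] unfolding l2_sq_def by (intro nn_integral_eq_integral[symmetric]) (auto simp: sq_int_integrable)
    then have "ennreal (l2_sq (\<lambda>z. F z - S n z)) \<le> ennreal (T n)" using fatou[of n] by simp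
    moreover have "0 \<le> T n" unfolding T_def by (intro suminf_nonneg summable_ignore_initial_segment[OF a]) auto
    ultimately show ?thesis by simp
  qed
  have T0: "T \<longlonglongrightarrow> 0"
    unfolding T_def using suminf_exist_split2[OF a] by simp
  assume h: "sq_int h"
  have "(\<lambda>n. l2_inner (S n) h) \<longlonglongrightarrow> l2_inner F h"
  proof (rule LIM_zero_cancel, rule Lim_null_comparison)
    have "cmod (l2_inner (S n) h - l2_inner F h) \<le> sqrt (T n) * sqrt (l2_sq h)" for n
    proof -
      have "cmod (l2_inner (S n) h - l2_inner F h) = cmod (l2_inner (\<lambda>z. F z - S n z) h)"
        using S Fsq h by (simp add: l2_inner_diff_left norm_minus_commute)
      also have "\<dots> \<le> sqrt (l2_sq (\<lambda>z. F z - S n z)) * sqrt (l2_sq h)"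
        by (rule l2_inner_le[OF FS h])
      also have "\<dots> \<le> sqrt (T n) * sqrt (l2_sq h)"
        by (intro mult_right_mono real_sqrt_le_mono bd) simp
      finally show ?thesis .
    qed
    then show "\<forall>\<^sub>F n in sequentially. cmod (l2_inner (S n) h - l2_inner F h) \<le> sqrt (T n) * sqrt (l2_sq h)"
      by simp
    show "(\<lambda>n. sqrt (T n) * sqrt (l2_sq h)) \<longlonglongrightarrow> 0"
      using tendsto_mult[OF tendsto_real_sqrt[OF T0] tendsto_const, of "sqrt (l2_sq h)"] by simp
  qed
  moreover have "l2_inner (S n) h = (\<Sum>k<n. a k * l2_inner (e k) h)" for n
    unfolding S_def using e h by (subst l2_inner_sum_left) (auto simp: l2_inner_cmult_left)
  ultimately show "(\<lambda>k. a k * l2_inner (e k) h) sums l2_inner F h"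
    by (simp add: sums_def)
qed

subsection \<open>Localization operators that are diagonal in an orthonormal sequence\<close>

text \<open>The trace norm of the rank-one operator built from \<open>u\<close> is at most the
  squared norm of \<open>u\<close>: split the product by the arithmetic-geometric mean, then apply
  Bessel to each family. All trace estimates below add up such rank-one bounds.\<close>

lemma sum_mult_inner_le:
  assumes e: "orthonormal_on {..<n} e" and f: "orthonormal_on {..<n} f" and u: "sq_int u"
  shows "(\<Sum>i<n. cmod (l2_inner (e i) u) * cmod (l2_inner u (f i))) \<le> l2_sq u"
proof -
  have "(\<Sum>i<n. cmod (l2_inner (e i) u) * cmod (l2_inner u (f i)))
      \<le> (\<Sum>i<n. ((cmod (l2_inner u (e i)))\<^sup>2 + (cmod (l2_inner u (f i)))\<^sup>2) / 2)"
  proof (rule sum_mono)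
    fix i
    have "cmod (l2_inner (e i) u) = cmod (l2_inner u (e i))"
      by (subst l2_inner_commute) simp
    then show "cmod (l2_inner (e i) u) * cmod (l2_inner u (f i))
        \<le> ((cmod (l2_inner u (e i)))\<^sup>2 + (cmod (l2_inner u (f i)))\<^sup>2) / 2"
      using sum_squares_bound[of "cmod (l2_inner u (e i))" "cmod (l2_inner u (f i))"] by simp
  qed
  also have "\<dots> = ((\<Sum>i<n. (cmod (l2_inner u (e i)))\<^sup>2) + (\<Sum>i<n. (cmod (l2_inner u (f i)))\<^sup>2)) / 2"
    by (simp add: sum.distrib flip: sum_divide_distrib)
  also have "\<dots> \<le> l2_sq u"
    using bessel[OF e _ u] bessel[OF f _ u] by simp
  finally show ?thesis .
qed

text \<open>Collects what the operator-theoretic half uses about the Hermite coefficients. The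
  kernel series is required at every pair of points, which lets integral operators be evaluated
  pointwise; the diagonal value 1 makes the densities of the \<open>w k\<close> add up to 1 at each
  point.\<close>

locale diagonal_localization =
  fixes w :: "nat \<Rightarrow> phase \<Rightarrow> complex" and g :: "real \<Rightarrow> complex" and \<Omega> :: "phase set"
    and \<mu> :: "nat \<Rightarrow> real"
  assumes w_on: "orthonormal_on UNIV w"
    and kernel_sums: "\<And>z z'. (\<lambda>k. w k z * cnj (w k z')) sums rkernel g z z'"
    and rkernel_diag: "\<And>z. rkernel g z z = 1"
    and \<Omega>_sets [measurable]: "\<Omega> \<in> sets borel"
    and \<Omega>_finite: "emeasure lborel \<Omega> < \<infinity>"
    and w_orth_\<Omega>: "\<And>k l. l2_inner (\<lambda>z. indicator \<Omega> z * w k z) (w l)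
          = (if k = l then complex_of_real (\<mu> k) else 0)"
begin

abbreviation "K \<equiv> rkernel g"
abbreviation "M \<equiv> loc_kernel g \<Omega>"

lemma w_sq [simp, intro]: "sq_int (w k)"
  using w_on by (rule orthonormal_onD) simp

lemma w_inner: "l2_inner (w k) (w l) = (if k = l then 1 else 0)"
  using w_on by (rule orthonormal_onD) simp_all

lemma w_l2_sq [simp]: "l2_sq (w k) = 1"
  using w_on by (rule orthonormal_l2_sq) simp

lemma w_norm_sums: "(\<lambda>k. (cmod (w k z))\<^sup>2) sums 1"
proof -
  have "(\<lambda>k. Re (w k z * cnj (w k z))) sums Re (K z z)"
    by (intro bounded_linear.sums[OF bounded_linear_Re] kernel_sums)
  then show ?thesis by (simp add: rkernel_diag mult_cnj_self flip: of_real_power)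
qed

lemma K_herm: "cnj (K z z') = K z' z"
proof (rule sums_unique2)
  show "(\<lambda>k. cnj (w k z * cnj (w k z'))) sums cnj (K z z')"
    by (intro sums_cnj[THEN iffD2] kernel_sums)
  show "(\<lambda>k. cnj (w k z * cnj (w k z'))) sums K z' z"
    using kernel_sums[of z' z] by (simp add: mult.commute)
qed

lemma \<mu>_eq: "\<mu> k = (LINT z|lborel. indicator \<Omega> z * (cmod (w k z))\<^sup>2)"
proof -
  have "complex_of_real (\<mu> k) = (LINT z|lborel. complex_of_real (indicator \<Omega> z * (cmod (w k z))\<^sup>2))"
    unfolding w_orth_\<Omega>[of k k, simplified, symmetric] l2_inner_def
    by (intro Bochner_Integration.integral_cong) (auto simp: indicator_def mult_cnj_self)
  then show ?thesis
    unfolding integral_complex_of_real by (rule of_real_eq_iff[THEN iffD1])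
qed

lemma \<mu>_integrable: "integrable lborel (\<lambda>z. indicator \<Omega> z * (cmod (w k z))\<^sup>2)"
proof -
  have "(cmod (indicator \<Omega> z * w k z))\<^sup>2 = indicator \<Omega> z * (cmod (w k z))\<^sup>2" for z
    by (auto simp: indicator_def)
  then show ?thesis
    using sq_int_integrable[OF sq_int_indicator[OF w_sq \<Omega>_sets], of k] by simp
qed

lemma \<mu>_nonneg [simp]: "0 \<le> \<mu> k"
  unfolding \<mu>_eq by (intro integral_nonneg_AE) auto

lemma \<mu>_le_1: "\<mu> k \<le> 1"
proof -
  have "\<mu> k \<le> (LINT z|lborel. (cmod (w k z))\<^sup>2)"
    unfolding \<mu>_eq
    by (intro integral_mono \<mu>_integrable sq_int_integrable w_sq)
       (auto simp: indicator_def)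
  then show ?thesis using w_l2_sq[of k] by (simp add: l2_sq_def)
qed

text \<open>The trace of \<open>M\<close>: integrate the pointwise identity
  \<open>w_norm_sums\<close> over \<open>\<Omega>\<close>, exchanging sum and integral for
  nonnegative terms.\<close>

lemma \<mu>_sums: "\<mu> sums measure lborel \<Omega>"
proof -
  have w: "w k \<in> borel_measurable borel" for k by (rule sq_int_measurable) simp
  have "(\<Sum>k. ennreal (\<mu> k)) = (\<Sum>k. \<integral>\<^sup>+z. ennreal (indicator \<Omega> z * (cmod (w k z))\<^sup>2) \<partial>lborel)"
    by (subst nn_integral_eq_integral[OF \<mu>_integrable]) (auto simp: \<mu>_eq)
  also have "\<dots> = (\<integral>\<^sup>+z. (\<Sum>k. ennreal (indicator \<Omega> z * (cmod (w k z))\<^sup>2)) \<partial>lborel)"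
    using w by (intro nn_integral_suminf[symmetric]) measurable
  also have "\<dots> = (\<integral>\<^sup>+z. indicator \<Omega> z \<partial>lborel)"
  proof (intro nn_integral_cong)
    fix z
    have "(\<lambda>k. ennreal ((cmod (w k z))\<^sup>2)) sums ennreal 1"
      by (subst sums_ennreal) (auto simp: w_norm_sums)
    then show "(\<Sum>k. ennreal (indicator \<Omega> z * (cmod (w k z))\<^sup>2)) = indicator \<Omega> z"
      using sums_unique[OF w_norm_sums[of z]] by (auto simp: indicator_def sums_iff)
  qed
  also have "\<dots> = ennreal (measure lborel \<Omega>)"
    using \<Omega>_finite by (simp add: emeasure_eq_ennreal_measure)
  finally have "(\<Sum>k. ennreal (\<mu> k)) = ennreal (measure lborel \<Omega>)" .
  then have "(\<lambda>k. ennreal (\<mu> k)) sums ennreal (measure lborel \<Omega>)"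
    by (simp add: sums_iff)
  then show ?thesis by (subst (asm) sums_ennreal) auto
qed

lemma K_column:
  shows K_column_sq: "sq_int (\<lambda>z. K z z')"
    and K_column_inner: "sq_int h \<Longrightarrow>
      (\<lambda>k. cnj (w k z') * l2_inner (w k) h) sums l2_inner (\<lambda>z. K z z') h"
proof -
  have s: "summable (\<lambda>k. (cmod (cnj (w k z')))\<^sup>2)"
    using w_norm_sums[of z'] by (simp add: sums_iff)
  have K: "(\<lambda>k. cnj (w k z') * w k z) sums K z z'" for z
    using kernel_sums[of z z'] by (simp add: mult.commute)
  show "sq_int (\<lambda>z. K z z')" by (rule pointwise_series_l2(1)[OF w_on s K])
  show "(\<lambda>k. cnj (w k z') * l2_inner (w k) h) sums l2_inner (\<lambda>z. K z z') h" if "sq_int h"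
    by (rule pointwise_series_l2(2)[OF w_on s K that])
qed

lemma inner_indicator: "l2_inner f (\<lambda>z. indicator \<Omega> z * h z) = l2_inner (\<lambda>z. indicator \<Omega> z * f z) h"
  unfolding l2_inner_def by (intro Bochner_Integration.integral_cong) (auto simp: indicator_def)

text \<open>\<open>M z z'\<close> is an inner product over \<open>\<Omega>\<close> of two columns of
  \<open>K\<close>. Expanding the column at \<open>z'\<close> against the restriction of
  \<open>w k\<close> leaves one term by orthogonality on \<open>\<Omega>\<close>; expanding the
  column at \<open>z\<close> then gives the series.\<close>

lemma M_sums: "(\<lambda>k. complex_of_real (\<mu> k) * w k z * cnj (w k z')) sums M z z'"
proof -
  have w\<Omega>: "sq_int (\<lambda>x. indicator \<Omega> x * w k x)" for k by (intro sq_int_indicator) auto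
  have K\<Omega>: "sq_int (\<lambda>x. indicator \<Omega> x * K x z')" by (intro sq_int_indicator K_column_sq) auto
  have coeff: "l2_inner (w k) (\<lambda>x. indicator \<Omega> x * K x z') = \<mu> k * w k z'" for k
  proof -
    have inn: "cnj (w l z') * l2_inner (w l) (\<lambda>x. indicator \<Omega> x * w k x) = (if l = k then cnj (w k z') * \<mu> k else 0)" for l
      unfolding inner_indicator using w_orth_\<Omega>[of l k] by auto
    have "(\<lambda>l. if l = k then cnj (w k z') * \<mu> k else 0) sums l2_inner (\<lambda>x. K x z') (\<lambda>x. indicator \<Omega> x * w k x)"
      using K_column_inner[OF w\<Omega>[of k], of z'] unfolding inn .
    then have "l2_inner (\<lambda>x. K x z') (\<lambda>x. indicator \<Omega> x * w k x) = cnj (w k z') * \<mu> k"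
      using sums_unique2[OF _ sums_single[of k "\<lambda>_. cnj (w k z') * \<mu> k"]] by blast
    then show ?thesis
      by (subst inner_indicator, subst l2_inner_commute) simp
  qed
  have "M z z' = cnj (l2_inner (\<lambda>x. K x z) (\<lambda>x. indicator \<Omega> x * K x z'))"
    unfolding l2_inner_commute[of "\<lambda>x. indicator \<Omega> x * K x z'", symmetric]
    by (simp add: loc_kernel_def l2_inner_def K_herm mult_ac)
  moreover have "(\<lambda>k. cnj (cnj (w k z) * (\<mu> k * w k z'))) sums cnj (l2_inner (\<lambda>x. K x z) (\<lambda>x. indicator \<Omega> x * K x z'))"
    using K_column_inner[OF K\<Omega>, of z] unfolding coeff by (rule sums_cnj[THEN iffD2])
  ultimately show ?thesis by (simp add: mult_ac)
qed

lemma M_apply_sums: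
  assumes f: "sq_int f"
  shows "(\<lambda>k. (\<mu> k * l2_inner f (w k)) * w k z) sums kernel_apply M f z"
proof -
  have s: "summable (\<lambda>k. (cmod (\<mu> k * cnj (w k z)))\<^sup>2)"
  proof (rule summable_comparison_test')
    show "summable (\<lambda>k. (cmod (w k z))\<^sup>2)" using w_norm_sums[of z] by (simp add: sums_iff)
    show "norm ((cmod (\<mu> k * cnj (w k z)))\<^sup>2) \<le> (cmod (w k z))\<^sup>2" if "k \<ge> 0" for k
      using \<mu>_le_1[of k] by (simp add: norm_mult power_mult_distrib mult_left_le_one_le power_le_one)
  qed
  have "(\<lambda>k. \<mu> k * cnj (w k z) * w k z') sums cnj (M z z')" for z'
    using sums_cnj[THEN iffD2, OF M_sums[of z z']] by simp
  from pointwise_series_l2(2)[OF w_on s this f]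
  have "(\<lambda>k. cnj (\<mu> k * cnj (w k z) * l2_inner (w k) f)) sums cnj (l2_inner (\<lambda>z'. cnj (M z z')) f)"
    by (rule sums_cnj[THEN iffD2])
  moreover have "cnj (l2_inner (\<lambda>z'. cnj (M z z')) f) = kernel_apply M f z"
    unfolding l2_inner_commute[of f, symmetric] by (simp add: l2_inner_def kernel_apply_def mult.commute)
  moreover have "cnj (l2_inner (w k) f) = l2_inner f (w k)" for k
    by (rule l2_inner_commute[symmetric])
  ultimately show ?thesis by (simp add: mult_ac)
qed

text \<open>Testing \<open>M\<close> against \<open>h\<close> turns eigenvalue equations that hold
  almost everywhere into exact identities, and matrix entries of this kind are all that the trace
  norm sees.\<close>

definition form :: "(phase \<Rightarrow> complex) \<Rightarrow> (phase \<Rightarrow> complex) \<Rightarrow> complex" where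
  "form f h = l2_inner (kernel_apply M f) h"

lemma M_apply:
  assumes f: "sq_int f"
  shows M_apply_sq: "sq_int (kernel_apply M f)"
    and form_sums: "sq_int h \<Longrightarrow> (\<lambda>k. \<mu> k * l2_inner f (w k) * l2_inner (w k) h) sums form f h"
proof -
  have s: "summable (\<lambda>k. (cmod (\<mu> k * l2_inner f (w k)))\<^sup>2)"
  proof (rule summable_comparison_test')
    show "summable (\<lambda>k. (cmod (l2_inner f (w k)))\<^sup>2)" by (rule bessel_summable[OF w_on f])
    show "norm ((cmod (\<mu> k * l2_inner f (w k)))\<^sup>2) \<le> (cmod (l2_inner f (w k)))\<^sup>2" if "k \<ge> 0" for k
      using \<mu>_le_1[of k] by (simp add: norm_mult power_mult_distrib mult_left_le_one_le power_le_one)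
  qed
  note * = pointwise_series_l2[OF w_on s M_apply_sums[OF f]]
  show "sq_int (kernel_apply M f)" by (rule *(1))
  show "(\<lambda>k. \<mu> k * l2_inner f (w k) * l2_inner (w k) h) sums form f h" if "sq_int h"
    unfolding form_def by (rule *(2)[OF that])
qed

lemma form_commute:
  assumes "sq_int f" "sq_int h"
  shows "form h f = cnj (form f h)"
proof (rule sums_unique2[OF form_sums[OF assms(2,1)]])
  have "cnj (l2_inner u v) = l2_inner v u" for u v by (rule l2_inner_commute[symmetric])
  then show "(\<lambda>k. \<mu> k * l2_inner h (w k) * l2_inner (w k) f) sums cnj (form f h)"
    using sums_cnj[THEN iffD2, OF form_sums[OF assms]] by (simp add: mult_ac)
qed

lemma form_residual_left:
  assumes f: "sq_int f" and h: "sq_int h" and q: "\<And>j. j \<in> J \<Longrightarrow> sq_int (q j)"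
  shows "form (\<lambda>z. f z - (\<Sum>j\<in>J. c j * q j z)) h = form f h - (\<Sum>j\<in>J. c j * form (q j) h)"
proof -
  have qs: "sq_int (\<lambda>z. \<Sum>j\<in>J. c j * q j z)" by (intro sq_int_lincomb q)
  have "l2_inner (\<lambda>z. f z - (\<Sum>j\<in>J. c j * q j z)) (w k)
     = l2_inner f (w k) - (\<Sum>j\<in>J. c j * l2_inner (q j) (w k))" for k
    using f q qs by (subst l2_inner_diff_left) (auto simp: l2_inner_sum_left l2_inner_cmult_left sq_int_cmult)
  then have "(\<lambda>k. \<mu> k * (l2_inner f (w k) - (\<Sum>j\<in>J. c j * l2_inner (q j) (w k))) * l2_inner (w k) h)
       sums form (\<lambda>z. f z - (\<Sum>j\<in>J. c j * q j z)) h"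
    using form_sums[OF sq_int_diff[OF f qs] h] by simp
  moreover have "(\<lambda>k. \<mu> k * l2_inner f (w k) * l2_inner (w k) h
       - (\<Sum>j\<in>J. c j * (\<mu> k * l2_inner (q j) (w k) * l2_inner (w k) h)))
       sums (form f h - (\<Sum>j\<in>J. c j * form (q j) h))"
    using f h q by (intro sums_diff sums_sum sums_mult form_sums)
  ultimately show ?thesis
    by (intro sums_unique2) (simp_all add: algebra_simps sum_distrib_left sum_distrib_right)
qed

text \<open>The projection onto the span of the \<open>q j\<close> commutes with the localization operator, so their
  difference splits into a part on this span with eigenvalues \<open>1 - \<kappa> j\<close> and a negative part on its complement of trace
  \<open>sum \<kappa> - |\<Omega>|\<close>.\<close>

lemma trace_bound_eigenprojection:
  assumes q: "orthonormal_on J q" "finite J" and card: "real (card J) = measure lborel \<Omega>"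
    and eig: "\<And>j h. j \<in> J \<Longrightarrow> sq_int h \<Longrightarrow> form (q j) h = complex_of_real (\<kappa> j) * l2_inner (q j) h"
    and \<kappa>: "\<And>j. j \<in> J \<Longrightarrow> \<kappa> j \<le> 1"
    and e: "orthonormal_on {..<n} e" and f: "orthonormal_on {..<n} f"
  shows "(\<Sum>i<n. cmod ((\<Sum>j\<in>J. l2_inner (e i) (q j) * l2_inner (q j) (f i)) - form (e i) (f i)))
     \<le> 2 * (measure lborel \<Omega> - sum \<kappa> J)"
proof -
  define res where "res u = (\<lambda>z. u z - (\<Sum>j\<in>J. l2_inner u (q j) * q j z))" for u
  have qsq: "sq_int (q j)" if "j \<in> J" for j using q that by (auto dest: orthonormal_onD)
  have qs: "sq_int (\<lambda>z. \<Sum>j\<in>J. c j * q j z)" for c by (intro sq_int_lincomb qsq)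
  have res_sq: "sq_int (res u)" if "sq_int u" for u
    unfolding res_def using that qs by (intro sq_int_diff)
  have res_q: "l2_inner (q j) (res u) = 0" if "j \<in> J" "sq_int u" for j u
  proof -
    have "l2_inner (res u) (q j) = 0"
      unfolding res_def using that q qs qsq
      by (simp add: l2_inner_diff_left l2_inner_lincomb[OF q])
    then show ?thesis by (subst l2_inner_commute) simp
  qed
  have res_move: "l2_inner (res u) v = l2_inner u (res v)" if "sq_int u" "sq_int v" for u v
  proof -
    have "l2_inner (res u) v = l2_inner u v - (\<Sum>j\<in>J. l2_inner u (q j) * l2_inner (q j) v)"
      unfolding res_def using that qs qsq
      by (subst l2_inner_diff_left) (auto simp: l2_inner_sum_left l2_inner_cmult_left sq_int_cmult)
    moreover have "l2_inner u (res v) = l2_inner u v - (\<Sum>j\<in>J. cnj (l2_inner v (q j)) * l2_inner u (q j))"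
      unfolding res_def using that qs qsq
      by (subst l2_inner_diff_right) (auto simp: l2_inner_sum_right l2_inner_cmult_right sq_int_cmult)
    ultimately show ?thesis
      by (simp add: l2_inner_commute[of _ v, symmetric] mult.commute)
  qed
  \<comment> \<open>Block diagonality: a cross term between some \<open>q j\<close> and a residual
    is \<open>\<kappa> j\<close> times their inner product, which is 0. The second argument is
    treated by hermitian symmetry of \<open>form\<close>.\<close>
  have form_res: "form u v = form (res u) (res v)
      + (\<Sum>j\<in>J. complex_of_real (\<kappa> j) * (l2_inner u (q j) * l2_inner (q j) v))"
    if u: "sq_int u" and v: "sq_int v" for u v
  proof -
    have "form (res u) (res v) = form u (res v)"
      unfolding res_def[of u] using u v qsq res_sq
      by (subst form_residual_left) (auto simp: eig res_q)
    also have "\<dots> = cnj (form (res v) u)"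
      using u v res_sq by (intro form_commute) auto
    also have "form (res v) u = form v u - (\<Sum>j\<in>J. l2_inner v (q j) * (\<kappa> j * l2_inner (q j) u))"
      unfolding res_def using u v qsq by (subst form_residual_left) (auto simp: eig)
    also have "cnj \<dots> = form u v - (\<Sum>j\<in>J. complex_of_real (\<kappa> j) * (l2_inner u (q j) * l2_inner (q j) v))"
      using form_commute[OF v u]
      by (simp add: l2_inner_commute[of _ v, symmetric] l2_inner_commute[of u, symmetric] mult_ac)
    finally show ?thesis by simp
  qed
  \<comment> \<open>Compressed to the complement of the span, \<open>M\<close> is the sum of the
    rank-one operators of the \<open>v k\<close> with weights \<open>\<mu> k\<close>; its trace is
    that of \<open>M\<close> minus the sum of the \<open>\<kappa> j\<close>.\<close>
  define v where "v k = res (w k)" for k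
  have v_sq: "sq_int (v k)" for k unfolding v_def by (intro res_sq) simp
  have v_sums: "(\<lambda>k. \<mu> k * l2_sq (v k)) sums (measure lborel \<Omega> - sum \<kappa> J)"
  proof -
    have \<kappa>_sums: "(\<lambda>k. \<mu> k * (cmod (l2_inner (w k) (q j)))\<^sup>2) sums \<kappa> j" if "j \<in> J" for j
    proof -
      have "form (q j) (q j) = \<kappa> j"
        using that q by (simp add: eig qsq orthonormal_onD)
      then have "(\<lambda>k. Re (\<mu> k * l2_inner (q j) (w k) * l2_inner (w k) (q j))) sums Re (complex_of_real (\<kappa> j))"
        using bounded_linear.sums[OF bounded_linear_Re form_sums[OF qsq qsq], OF that that] by simp
      moreover have "l2_inner (q j) (w k) * l2_inner (w k) (q j) = (cmod (l2_inner (w k) (q j)))\<^sup>2" for k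
        using mult_cnj_self[of "l2_inner (w k) (q j)"]
        by (simp add: l2_inner_commute[of "q j" "w k"] mult.commute)
      ultimately show ?thesis by (simp add: mult.assoc flip: of_real_power of_real_mult)
    qed
    have v_l2_sq: "l2_sq (v k) = 1 - (\<Sum>j\<in>J. (cmod (l2_inner (w k) (q j)))\<^sup>2)" for k
      unfolding v_def res_def by (subst l2_sq_residual[OF q]) auto
    have "(\<lambda>k. \<mu> k - (\<Sum>j\<in>J. \<mu> k * (cmod (l2_inner (w k) (q j)))\<^sup>2)) sums (measure lborel \<Omega> - sum \<kappa> J)"
      by (intro sums_diff sums_sum \<mu>_sums \<kappa>_sums)
    then show ?thesis by (simp add: v_l2_sq right_diff_distrib sum_distrib_left)
  qed
  have esq: "sq_int (e i)" and fsq: "sq_int (f i)" if "i < n" for i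
    using e f that by (auto dest: orthonormal_onD)
  \<comment> \<open>On the span the difference has eigenvalues \<open>1 - \<kappa> j\<close>, all
    nonnegative; their sum starts from \<open>card J\<close>, which \<open>card\<close> turns into
    the area.\<close>
  have bound1: "(\<Sum>i<n. cmod (\<Sum>j\<in>J. complex_of_real (1 - \<kappa> j) * (l2_inner (e i) (q j) * l2_inner (q j) (f i))))
     \<le> measure lborel \<Omega> - sum \<kappa> J"
  proof -
    have "(\<Sum>i<n. cmod (\<Sum>j\<in>J. complex_of_real (1 - \<kappa> j) * (l2_inner (e i) (q j) * l2_inner (q j) (f i))))
      \<le> (\<Sum>i<n. \<Sum>j\<in>J. (1 - \<kappa> j) * (cmod (l2_inner (e i) (q j)) * cmod (l2_inner (q j) (f i))))"
      using \<kappa> by (intro sum_mono order_trans[OF norm_sum] sum_mono) (simp add: norm_mult flip: of_real_diff)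
    also have "\<dots> = (\<Sum>j\<in>J. (1 - \<kappa> j) * (\<Sum>i<n. cmod (l2_inner (e i) (q j)) * cmod (l2_inner (q j) (f i))))"
      by (subst sum.swap) (simp add: sum_distrib_left)
    also have "\<dots> \<le> (\<Sum>j\<in>J. (1 - \<kappa> j) * 1)"
    proof (intro sum_mono mult_left_mono)
      fix j assume j: "j \<in> J"
      show "(\<Sum>i<n. cmod (l2_inner (e i) (q j)) * cmod (l2_inner (q j) (f i))) \<le> 1"
        using sum_mult_inner_le[OF e f qsq[OF j]] orthonormal_l2_sq[OF q(1) j] by simp
    qed (use \<kappa> in auto)
    also have "\<dots> = measure lborel \<Omega> - sum \<kappa> J"
      using card by (simp add: sum_subtractf)
    finally show ?thesis .
  qed
  \<comment> \<open>The rank-one bound is applied for each fixed \<open>k\<close>, to the finite sum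
    over \<open>i\<close>; only then is the series over \<open>k\<close> taken, with
    \<open>v_sums\<close> as majorant.\<close>
  have bound2: "(\<Sum>i<n. cmod (form (res (e i)) (res (f i)))) \<le> measure lborel \<Omega> - sum \<kappa> J"
  proof -
    define t where "t i k = \<mu> k * (cmod (l2_inner (e i) (v k)) * cmod (l2_inner (v k) (f i)))" for i k
    have t_le: "(\<Sum>i<n. t i k) \<le> \<mu> k * l2_sq (v k)" for k
      unfolding t_def sum_distrib_left[symmetric]
      by (intro mult_left_mono sum_mult_inner_le e f v_sq) simp
    have t_nonneg: "0 \<le> t i k" for i k by (simp add: t_def)
    have t_summable: "summable (t i)" if "i < n" for i
    proof (rule summable_comparison_test')
      show "summable (\<lambda>k. \<mu> k * l2_sq (v k))" using v_sums by (simp add: sums_iff)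
      fix k
      have "t i k \<le> (\<Sum>i<n. t i k)"
        using that t_nonneg by (intro member_le_sum) auto
      then show "norm (t i k) \<le> \<mu> k * l2_sq (v k)"
        using order_trans[OF _ t_le] t_nonneg[of i k] by simp
    qed
    have "cmod (form (res (e i)) (res (f i))) \<le> (\<Sum>k. t i k)" if i: "i < n" for i
    proof -
      have eq: "l2_inner (res (e i)) (w k) = l2_inner (e i) (v k)"
        "l2_inner (w k) (res (f i)) = l2_inner (v k) (f i)" for k
        unfolding v_def using esq[OF i] fsq[OF i] by (simp_all add: res_move)
      have nt: "norm (\<mu> k * l2_inner (res (e i)) (w k) * l2_inner (w k) (res (f i))) = t i k" for k
        by (simp add: t_def eq norm_mult)
      have "form (res (e i)) (res (f i)) = (\<Sum>k. \<mu> k * l2_inner (res (e i)) (w k) * l2_inner (w k) (res (f i)))"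
        using form_sums[OF res_sq res_sq] esq[OF i] fsq[OF i] by (simp add: sums_iff)
      then show ?thesis
        using summable_norm[of "\<lambda>k. \<mu> k * l2_inner (res (e i)) (w k) * l2_inner (w k) (res (f i))"]
          t_summable[OF i] unfolding nt by simp
    qed
    then have "(\<Sum>i<n. cmod (form (res (e i)) (res (f i)))) \<le> (\<Sum>i<n. \<Sum>k. t i k)"
      by (intro sum_mono) auto
    also have "\<dots> = (\<Sum>k. \<Sum>i<n. t i k)"
      using t_summable by (intro suminf_sum[symmetric]) auto
    also have "\<dots> \<le> (\<Sum>k. \<mu> k * l2_sq (v k))"
      using t_le t_summable v_sums by (intro suminf_le summable_sum) (auto simp: sums_iff)
    also have "\<dots> = measure lborel \<Omega> - sum \<kappa> J" using v_sums by (simp add: sums_iff)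
    finally show ?thesis .
  qed
  have "(\<Sum>i<n. cmod ((\<Sum>j\<in>J. l2_inner (e i) (q j) * l2_inner (q j) (f i)) - form (e i) (f i)))
     \<le> (\<Sum>i<n. cmod (\<Sum>j\<in>J. complex_of_real (1 - \<kappa> j) * (l2_inner (e i) (q j) * l2_inner (q j) (f i)))
         + cmod (form (res (e i)) (res (f i))))"
  proof (intro sum_mono)
    fix i assume "i \<in> {..<n}"
    then have eq: "(\<Sum>j\<in>J. l2_inner (e i) (q j) * l2_inner (q j) (f i)) - form (e i) (f i)
      = (\<Sum>j\<in>J. complex_of_real (1 - \<kappa> j) * (l2_inner (e i) (q j) * l2_inner (q j) (f i)))
        - form (res (e i)) (res (f i))"
      by (simp add: form_res esq fsq left_diff_distrib sum_subtractf)
    show "cmod ((\<Sum>j\<in>J. l2_inner (e i) (q j) * l2_inner (q j) (f i)) - form (e i) (f i))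
      \<le> cmod (\<Sum>j\<in>J. complex_of_real (1 - \<kappa> j) * (l2_inner (e i) (q j) * l2_inner (q j) (f i)))
         + cmod (form (res (e i)) (res (f i)))"
      unfolding eq by (rule norm_triangle_ineq4)
  qed
  then show ?thesis
    using bound1 bound2 by (simp add: sum.distrib)
qed

lemma form_w:
  assumes "sq_int h"
  shows "form (w k) h = \<mu> k * l2_inner (w k) h"
proof (rule sums_unique2[OF form_sums[OF w_sq assms]])
  have "\<mu> l * l2_inner (w k) (w l) * l2_inner (w l) h = (if l = k then \<mu> k * l2_inner (w k) h else 0)" for l
    by (simp add: w_inner)
  then show "(\<lambda>l. \<mu> l * l2_inner (w k) (w l) * l2_inner (w l) h) sums (\<mu> k * l2_inner (w k) h)"
    using sums_single[of k "\<lambda>_. \<mu> k * l2_inner (w k) h"] by simp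
qed

lemma form_eigen:
  assumes "sq_int f" "AE z in lborel. kernel_apply M f z = complex_of_real \<kappa> * f z" "sq_int h"
  shows "form f h = \<kappa> * l2_inner f h"
  using l2_inner_AE_cong_left[OF assms(2) M_apply_sq[OF assms(1)] sq_int_cmult[OF assms(1)] assms(3)]
  by (simp add: form_def l2_inner_cmult_left)

section \<open>Comparison of an arbitrary eigensystem with the diagonal one\<close>

context
  fixes lam :: "nat \<Rightarrow> real" and p :: "nat \<Rightarrow> phase \<Rightarrow> complex"
  assumes eigensystem: "eigensystem M lam p"
begin

lemma p_on: "orthonormal_on {1..} p"
  using eigensystem by (simp add: eigensystem_def)

lemma p_sq: "1 \<le> j \<Longrightarrow> sq_int (p j)"
  using p_on by (rule orthonormal_onD) simp

lemma lam_decreasing: "1 \<le> i \<Longrightarrow> i \<le> j \<Longrightarrow> lam j \<le> lam i"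
  using eigensystem by (auto simp: eigensystem_def)

lemma form_p: "1 \<le> j \<Longrightarrow> sq_int h \<Longrightarrow> form (p j) h = lam j * l2_inner (p j) h"
  using eigensystem by (intro form_eigen p_sq) (auto simp: eigensystem_def)

text \<open>Each \<open>lam j\<close> is a combination of the \<open>\<mu> k\<close> with the
  weights \<open>(cmod (l2_inner (p j) (w k)))\<^sup>2\<close>, whose sum is at most 1 by
  Bessel.\<close>

lemma lam_bounds:
  assumes j: "1 \<le> j"
  shows "0 \<le> lam j" "lam j \<le> 1"
proof -
  have eq: "l2_inner (p j) (w k) * l2_inner (w k) (p j) = (cmod (l2_inner (p j) (w k)))\<^sup>2" for k
    using mult_cnj_self[of "l2_inner (p j) (w k)"] by (simp add: l2_inner_commute[of "w k"])
  have "form (p j) (p j) = lam j"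
    using j orthonormal_onD(2)[OF p_on, of j j] by (simp add: form_p p_sq)
  then have "(\<lambda>k. Re (\<mu> k * l2_inner (p j) (w k) * l2_inner (w k) (p j))) sums Re (complex_of_real (lam j))"
    using bounded_linear.sums[OF bounded_linear_Re form_sums[OF p_sq p_sq], OF j j] by simp
  then have s: "(\<lambda>k. \<mu> k * (cmod (l2_inner (p j) (w k)))\<^sup>2) sums lam j"
    by (simp add: mult.assoc eq flip: of_real_power of_real_mult)
  then show "0 \<le> lam j"
    by (rule sums_le[OF _ sums_zero, rotated]) simp
  have "lam j \<le> (\<Sum>k. (cmod (l2_inner (p j) (w k)))\<^sup>2)"
    using \<mu>_le_1
    by (intro sums_le[OF _ s summable_sums[OF bessel_summable(1)[OF w_on p_sq[OF j]]]])
       (simp add: mult_left_le_one_le)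
  also have "\<dots> \<le> l2_sq (p j)" by (rule bessel_summable(2)[OF w_on p_sq[OF j]])
  also have "\<dots> = 1" using j by (intro orthonormal_l2_sq[OF p_on]) simp
  finally show "lam j \<le> 1" .
qed

text \<open>A form of Ky Fan's maximum principle. Each \<open>\<mu> k\<close> is at most
  \<open>lam N\<close> plus an average of the excesses \<open>lam j - lam N\<close>; summed over
  \<open>k\<close>, the weights of each excess total at most 1 by Bessel for \<open>p j\<close>, and
  the multiples of \<open>lam N\<close> cancel.\<close>

lemma sum_\<mu>_le_sum_lam:
  assumes N: "1 \<le> N"
  shows "(\<Sum>k<N. \<mu> k) \<le> (\<Sum>j=1..N. lam j)"
proof -
  define c where "c k j = (cmod (l2_inner (w k) (p j)))\<^sup>2" for k j
  have pN: "orthonormal_on {1..N} p" by (rule orthonormal_on_subset[OF p_on]) auto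
  have \<mu>_bound: "\<mu> k \<le> (\<Sum>j=1..N. (lam j - lam N) * c k j) + lam N" for k
  proof (cases "\<mu> k \<le> lam N")
    case True
    have "0 \<le> (\<Sum>j=1..N. (lam j - lam N) * c k j)"
      unfolding c_def using lam_decreasing by (intro sum_nonneg mult_nonneg_nonneg) auto
    then show ?thesis using True by simp
  next
    case False
    have ort: "l2_inner (w k) (p j) = 0" if j: "1 \<le> j" and ne: "lam j \<noteq> \<mu> k" for j
    proof -
      have "\<mu> k * l2_inner (w k) (p j) = form (w k) (p j)"
        using j by (simp add: form_w p_sq)
      also have "\<dots> = cnj (form (p j) (w k))" using j by (intro form_commute p_sq) auto
      also have "\<dots> = lam j * l2_inner (w k) (p j)"
        using j by (simp add: form_p l2_inner_commute[of "w k"])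
      finally show ?thesis using ne by simp
    qed
    \<comment> \<open>An eigenfunction with \<open>\<mu> k\<close> above \<open>lam N\<close> lies
      in the span of the first \<open>N\<close> functions \<open>p j\<close>. The residual
      \<open>v\<close> is orthogonal to these by construction and to the later ones because their
      eigenvalues differ from \<open>\<mu> k\<close>; so \<open>M\<close> annihilates
      \<open>v\<close>. As \<open>\<mu> k\<close> is nonzero, \<open>v\<close> is orthogonal to
      \<open>w k\<close>, and therefore to itself.\<close>
    define v where "v z = w k z - (\<Sum>j=1..N. l2_inner (w k) (p j) * p j z)" for z
    have ps: "sq_int (\<lambda>z. \<Sum>j=1..N. l2_inner (w k) (p j) * p j z)"
      by (intro sq_int_lincomb p_sq) auto
    have v_sq: "sq_int v" unfolding v_def by (intro sq_int_diff ps w_sq)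
    have v_perp: "l2_inner v (p j) = 0" if j: "1 \<le> j" for j
    proof (cases "j \<le> N")
      case True
      then show ?thesis unfolding v_def using j ps
        by (subst l2_inner_diff_left[OF w_sq ps p_sq], simp, subst l2_inner_lincomb[OF pN]) auto
    next
      case False
      then have "lam j \<le> lam N" using N by (intro lam_decreasing) auto
      then have "l2_inner (w k) (p j) = 0" using \<open>\<not> \<mu> k \<le> lam N\<close> j by (intro ort) auto
      moreover have "l2_inner (\<lambda>z. \<Sum>i=1..N. l2_inner (w k) (p i) * p i z) (p j) = 0"
        using False j by (subst l2_inner_sum_left)
          (auto simp: p_sq sq_int_cmult l2_inner_cmult_left orthonormal_onD(2)[OF p_on])
      ultimately show ?thesis unfolding v_def using j ps by (simp add: l2_inner_diff_left p_sq)
    qed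
    then have "AE z in lborel. kernel_apply M v z = complex_of_real 0 * v z"
      using eigensystem v_sq by (auto simp: eigensystem_def)
    then have "form v (w k) = 0" using form_eigen[OF v_sq _ w_sq, of 0] by simp
    then have "\<mu> k * l2_inner (w k) v = 0"
      using form_commute[OF v_sq w_sq, of k] v_sq by (simp add: form_w)
    then have "l2_inner (w k) v = 0" using False lam_bounds[OF N] by auto
    then have "l2_inner v (w k) = 0" by (subst l2_inner_commute) simp
    then have "l2_sq v = 0"
    proof -
      have "l2_inner v v = l2_inner v (w k) - (\<Sum>j=1..N. cnj (l2_inner (w k) (p j)) * l2_inner v (p j))"
        by (subst (2) v_def[abs_def], subst l2_inner_diff_right[OF w_sq ps v_sq], subst l2_inner_sum_right)
           (auto simp: v_sq p_sq sq_int_cmult l2_inner_cmult_right)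
      then show ?thesis using v_perp \<open>l2_inner v (w k) = 0\<close> by (simp add: l2_inner_self)
    qed
    then have one: "(\<Sum>j=1..N. c k j) = 1"
      using l2_sq_residual[OF pN _ w_sq, of k] unfolding v_def c_def by simp
    \<comment> \<open>A nonzero weight \<open>c k j\<close> forces \<open>lam j = \<mu> k\<close>,
      since eigenfunctions to different eigenvalues are orthogonal.\<close>
    have "(\<Sum>j=1..N. lam j * c k j) = (\<Sum>j=1..N. \<mu> k * c k j)"
    proof (intro sum.cong refl)
      fix j assume "j \<in> {1..N}"
      then show "lam j * c k j = \<mu> k * c k j"
        using ort[of j] by (cases "lam j = \<mu> k") (auto simp: c_def)
    qed
    then show ?thesis
      using one by (simp add: left_diff_distrib sum_subtractf flip: sum_distrib_left)
  qed
  have "(\<Sum>k<N. \<mu> k) \<le> (\<Sum>k<N. (\<Sum>j=1..N. (lam j - lam N) * c k j) + lam N)"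
    by (intro sum_mono \<mu>_bound)
  also have "\<dots> = (\<Sum>j=1..N. (lam j - lam N) * (\<Sum>k<N. c k j)) + N * lam N"
    unfolding sum.distrib by (subst sum.swap) (simp add: sum_distrib_left)
  also have "\<dots> \<le> (\<Sum>j=1..N. (lam j - lam N) * 1) + N * lam N"
  proof (intro add_right_mono sum_mono mult_left_mono)
    fix j assume j: "j \<in> {1..N}"
    have "(\<Sum>k<N. c k j) = (\<Sum>k<N. (cmod (l2_inner (p j) (w k)))\<^sup>2)"
      unfolding c_def by (subst l2_inner_commute) simp
    also have "\<dots> \<le> l2_sq (p j)"
      using j by (intro bessel p_sq orthonormal_on_subset[OF w_on]) auto
    also have "\<dots> = 1" using j by (intro orthonormal_l2_sq[OF p_on]) simp
    finally show "(\<Sum>k<N. c k j) \<le> 1" .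
    show "0 \<le> lam j - lam N" using j lam_decreasing by auto
  qed
  also have "\<dots> = (\<Sum>j=1..N. lam j)" by (simp add: sum_subtractf)
  finally show ?thesis .
qed

text \<open>Triangle inequality through \<open>M\<close>: each projection contributes twice its own
  eigenvalue deficit, and the deficit of the \<open>p j\<close> is the smaller one. Hence 4.\<close>

lemma trace_norm_fwh_le:
  assumes N: "measure lborel \<Omega> = real N"
  shows "trace_norm (\<lambda>z z'. fwh_kernel \<Omega> p z z' - (\<Sum>k<N. w k z * cnj (w k z')))
    \<le> ereal (4 * (real N - (\<Sum>k<N. \<mu> k)))"
proof -
  let ?D = "\<lambda>z z'. fwh_kernel \<Omega> p z z' - (\<Sum>k<N. w k z * cnj (w k z'))"
  have wN: "orthonormal_on {..<N} w" by (rule orthonormal_on_subset[OF w_on]) auto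
  have pN: "orthonormal_on {1..N} p" by (rule orthonormal_on_subset[OF p_on]) auto
  have mono: "(\<Sum>k<N. \<mu> k) \<le> (\<Sum>j=1..N. lam j)"
    using sum_\<mu>_le_sum_lam by (cases "N = 0") auto
  have apply_D: "kernel_apply ?D u z = (\<Sum>j=1..N. l2_inner u (p j) * p j z) - (\<Sum>k<N. l2_inner u (w k) * w k z)"
    if u: "sq_int u" for u z
  proof -
    have int: "integrable lborel (\<lambda>z'. \<Sum>j\<in>J. q j z * (u z' * cnj (q j z')))"
      and eq: "(LINT z'|lborel. (\<Sum>j\<in>J. q j z * (u z' * cnj (q j z')))) = (\<Sum>j\<in>J. l2_inner u (q j) * q j z)"
      if "orthonormal_on J q" for J and q :: "nat \<Rightarrow> phase \<Rightarrow> complex"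
    proof -
      have i: "integrable lborel (\<lambda>z'. q j z * (u z' * cnj (q j z')))" if "j \<in> J" for j
        using orthonormal_onD(1)[OF \<open>orthonormal_on J q\<close> that] u
        by (intro integrable_mult_right sq_int_integrable_mult) auto
      then show "integrable lborel (\<lambda>z'. \<Sum>j\<in>J. q j z * (u z' * cnj (q j z')))"
        by (intro Bochner_Integration.integrable_sum)
      show "(LINT z'|lborel. (\<Sum>j\<in>J. q j z * (u z' * cnj (q j z')))) = (\<Sum>j\<in>J. l2_inner u (q j) * q j z)"
        by (subst Bochner_Integration.integral_sum[OF i]) (simp_all add: l2_inner_def mult.commute)
    qed
    \<comment> \<open>As the area is the integer \<open>N\<close>, the ceiling in
      \<open>fwh_kernel\<close> leaves exactly \<open>N\<close> terms.\<close>
    have "kernel_apply ?D u z = (LINT z'|lborel. (\<Sum>j=1..N. p j z * (u z' * cnj (p j z')))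
        - (\<Sum>k<N. w k z * (u z' * cnj (w k z'))))"
      unfolding kernel_apply_def fwh_kernel_def N
      by (simp add: left_diff_distrib right_diff_distrib sum_distrib_right sum_distrib_left mult_ac)
    then show ?thesis
      using int[OF pN] int[OF wN] eq[OF pN] eq[OF wN] by simp
  qed
  show ?thesis
    unfolding trace_norm_def
  proof (rule SUP_least)
    fix x :: "nat \<times> (nat \<Rightarrow> phase \<Rightarrow> complex) \<times> (nat \<Rightarrow> phase \<Rightarrow> complex)"
    assume "x \<in> {(n, e, f). orthonormal_on {..<n} e \<and> orthonormal_on {..<n} f}"
    then obtain n e f where x: "x = (n, e, f)"
      and e: "orthonormal_on {..<n} e" and f: "orthonormal_on {..<n} f" by auto
    have "cmod (l2_inner (kernel_apply ?D (e i)) (f i))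
       \<le> cmod ((\<Sum>j=1..N. l2_inner (e i) (p j) * l2_inner (p j) (f i)) - form (e i) (f i))
        + cmod ((\<Sum>j<N. l2_inner (e i) (w j) * l2_inner (w j) (f i)) - form (e i) (f i))" if i: "i < n" for i
    proof -
      have ei: "sq_int (e i)" and fi: "sq_int (f i)" using e f i by (auto dest: orthonormal_onD)
      have s: "sq_int (\<lambda>z. \<Sum>j\<in>J. l2_inner (e i) (q j) * q j z)"
        and l: "l2_inner (\<lambda>z. \<Sum>j\<in>J. l2_inner (e i) (q j) * q j z) (f i)
            = (\<Sum>j\<in>J. l2_inner (e i) (q j) * l2_inner (q j) (f i))"
        if "orthonormal_on J q" for J and q :: "nat \<Rightarrow> phase \<Rightarrow> complex"
        using that fi orthonormal_onD(1)[OF that]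
        by (auto simp: l2_inner_sum_left l2_inner_cmult_left sq_int_cmult intro!: sq_int_lincomb)
      have "l2_inner (kernel_apply ?D (e i)) (f i)
         = (\<Sum>j=1..N. l2_inner (e i) (p j) * l2_inner (p j) (f i))
           - (\<Sum>j<N. l2_inner (e i) (w j) * l2_inner (w j) (f i))"
        using l2_inner_diff_left[OF s[OF pN] s[OF wN] fi] l[OF pN] l[OF wN]
        unfolding apply_D[OF ei, abs_def] by simp
      then show ?thesis
        using norm_triangle_ineq4[of
            "(\<Sum>j=1..N. l2_inner (e i) (p j) * l2_inner (p j) (f i)) - form (e i) (f i)"
            "(\<Sum>j<N. l2_inner (e i) (w j) * l2_inner (w j) (f i)) - form (e i) (f i)"] by simp
    qed
    then have "(\<Sum>i<n. cmod (l2_inner (kernel_apply ?D (e i)) (f i)))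
      \<le> (\<Sum>i<n. cmod ((\<Sum>j=1..N. l2_inner (e i) (p j) * l2_inner (p j) (f i)) - form (e i) (f i))
        + cmod ((\<Sum>j<N. l2_inner (e i) (w j) * l2_inner (w j) (f i)) - form (e i) (f i)))"
      by (intro sum_mono) auto
    also have "\<dots> \<le> 2 * (measure lborel \<Omega> - (\<Sum>j=1..N. lam j)) + 2 * (measure lborel \<Omega> - (\<Sum>k<N. \<mu> k))"
      unfolding sum.distrib
      by (intro add_mono trace_bound_eigenprojection pN wN e f)
         (auto simp: N form_p form_w lam_bounds \<mu>_le_1)
    also have "\<dots> \<le> 4 * (real N - (\<Sum>k<N. \<mu> k))"
      using mono by (simp add: N)
    finally show "ereal (\<Sum>i<fst x. cmod (l2_inner (kernel_apply ?D (fst (snd x) i)) (snd (snd x) i)))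
        \<le> ereal (4 * (real N - (\<Sum>k<N. \<mu> k)))"
      by (simp only: x fst_conv snd_conv ereal_less_eq)
  qed
qed

end

end

subsection \<open>Hermite functions\<close>

text \<open>The normalized Hermite functions by their three-term recurrence. This form yields ladder
  relations and decay by induction; agreement with the derivative formula is
  \<open>hermite_eq\<close>.\<close>

fun hfun :: "nat \<Rightarrow> real \<Rightarrow> real" where
  "hfun 0 t = 2 powr (1/4) * exp (- pi * t\<^sup>2)"
| "hfun (Suc r) t = (2 * sqrt pi * t * hfun r t - sqrt r * hfun (r - 1) t) / sqrt (Suc r)"

declare hfun.simps(2) [simp del]

lemma hfun_raise: "sqrt (Suc r) * hfun (Suc r) t = 2 * sqrt pi * t * hfun r t - sqrt r * hfun (r - 1) t"
  by (simp add: hfun.simps(2))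

text \<open>For \<open>r = 0\<close> the truncated index \<open>r - 1\<close> is harmless because of the factor \<open>sqrt r\<close>.\<close>

lemma hfun_deriv_lower:
  "(hfun r has_real_derivative 2 * sqrt pi * sqrt r * hfun (r - 1) t - 2 * pi * t * hfun r t) (at t)"
proof (induction r arbitrary: t rule: less_induct)
  case (less r)
  consider "r = 0" | s where "r = Suc s" by (cases r) auto
  then show ?case
  proof cases
    case 1
    have "((\<lambda>t. 2 powr (1/4) * exp (- pi * t\<^sup>2)) has_real_derivative - 2 * pi * t * (2 powr (1/4) * exp (- pi * t\<^sup>2))) (at t)"
      by (auto intro!: derivative_eq_intros)
    moreover have "hfun 0 = (\<lambda>t. 2 powr (1/4) * exp (- pi * t\<^sup>2))" by (simp add: fun_eq_iff)
    ultimately show ?thesis using 1 by simp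
  next
    case (2 s)
    have h: "hfun r = (\<lambda>t. (2 * sqrt pi * t * hfun s t - sqrt s * hfun (s - 1) t) / sqrt (Suc s))"
      by (simp add: 2 hfun.simps(2) fun_eq_iff)
    define d where "d = 2 * sqrt pi * sqrt s * hfun (s - 1) t - 2 * pi * t * hfun s t"
    define d1 where "d1 = 2 * sqrt pi * sqrt (s - 1) * hfun (s - 2) t - 2 * pi * t * hfun (s - 1) t"
    have ds: "(hfun s has_real_derivative d) (at t)"
      unfolding d_def using less[of s t] 2 by simp
    have ds1: "((\<lambda>t. sqrt s * hfun (s - 1) t) has_real_derivative sqrt s * d1) (at t)"
    proof (cases "s = 0")
      case False
      then show ?thesis unfolding d1_def using less[of "s - 1" t] 2
        by (intro DERIV_cmult) (simp add: numeral_2_eq_2)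
    qed simp
    have "(hfun r has_real_derivative (2 * sqrt pi * hfun s t + 2 * sqrt pi * t * d - sqrt s * d1) / sqrt (Suc s)) (at t)"
    proof -
      have lin: "((\<lambda>t. 2 * sqrt pi * t) has_real_derivative 2 * sqrt pi) (at t)"
        by (auto intro!: derivative_eq_intros)
      show ?thesis
        using DERIV_cdivide[OF DERIV_diff[OF DERIV_mult[OF lin ds] ds1], of "sqrt (Suc s)"]
        unfolding h by (simp add: mult.commute[of d])
    qed
    moreover have "(2 * sqrt pi * hfun s t + 2 * sqrt pi * t * d - sqrt s * d1) / sqrt (Suc s)
        = 2 * sqrt pi * sqrt (Suc s) * hfun s t - 2 * pi * t * hfun r t"
    proof -
      \<comment> \<open>The recurrence one index down, multiplied by \<open>sqrt s\<close> so that
        it also holds for \<open>s = 0\<close>, where the truncated index would otherwise spoil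
        it.\<close>
      have low: "sqrt s * (sqrt s * hfun s t) = sqrt s * (2 * sqrt pi * t * hfun (s - 1) t - sqrt (s - 1) * hfun (s - 2) t)"
        using hfun_raise[of "s - 1" t] by (cases s) (simp_all add: numeral_2_eq_2)
      have "2 * sqrt pi * hfun s t + 2 * sqrt pi * t * d - sqrt s * d1
          = 2 * sqrt pi * hfun s t + 2 * sqrt pi * (sqrt s * (sqrt s * hfun s t))
            - 2 * pi * t * (2 * sqrt pi * t * hfun s t - sqrt s * hfun (s - 1) t)"
        unfolding low d_def d1_def by (simp add: algebra_simps)
      also have "sqrt s * (sqrt s * hfun s t) = s * hfun s t"
        by (simp flip: mult.assoc)
      also have "2 * sqrt pi * t * hfun s t - sqrt s * hfun (s - 1) t = sqrt (Suc s) * hfun r t"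
        using hfun_raise[of s t] 2 by simp
      also have "2 * sqrt pi * hfun s t + 2 * sqrt pi * (s * hfun s t) = 2 * sqrt pi * hfun s t * (sqrt (Suc s) * sqrt (Suc s))"
        by (simp add: algebra_simps)
      finally show ?thesis by (simp add: field_simps)
    qed
    ultimately show ?thesis using 2 by simp
  qed
qed

text \<open>The recurrence trades the lowered term of the derivative for a raised one, which flips
  the sign of the term in \<open>t\<close>. Integration by parts uses one form on each
  factor.\<close>

lemma hfun_deriv_raise:
  "(hfun r has_real_derivative 2 * pi * t * hfun r t - 2 * sqrt pi * sqrt (Suc r) * hfun (Suc r) t) (at t)"
proof -
  have "2 * pi * t * hfun r t - 2 * sqrt pi * sqrt (Suc r) * hfun (Suc r) t
     = 2 * sqrt pi * sqrt r * hfun (r - 1) t - 2 * pi * t * hfun r t"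
    unfolding mult.assoc[of _ "sqrt (Suc r)"] hfun_raise by (simp add: algebra_simps)
  then show ?thesis using hfun_deriv_lower[of r t] by (simp only:)
qed

lemma continuous_hfun [continuous_intros]: "continuous_on S f \<Longrightarrow> continuous_on S (\<lambda>x. hfun r (f x))"
  by (rule continuous_on_compose2[of UNIV "hfun r"])
     (auto intro: DERIV_continuous_on has_field_derivative_at_within hfun_deriv_lower)

text \<open>In the raising form, the derivative of \<open>hfun r t * exp (- pi * t\<^sup>2)\<close>
  has a single term, because the two contributions with the factor \<open>t\<close> cancel. So each
  differentiation just raises the index.\<close>

lemma hermite_eq: "hermite r t = complex_of_real (hfun r t)"
proof -
  have rodrigues: "(deriv ^^ r) (\<lambda>s. exp (- 2 * pi * s\<^sup>2))
      = (\<lambda>t. hfun r t * exp (- pi * t\<^sup>2) / (2 powr (1/4) / sqrt (fact r) * (- 1 / (2 * sqrt pi)) ^ r))"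
  proof (induction r)
    case 0
    show ?case by (auto simp: fun_eq_iff simp flip: exp_add)
  next
    case (Suc r)
    define c where "c r = 2 powr (1/4) / sqrt (fact r) * (- 1 / (2 * sqrt pi)) ^ r" for r
    have c: "c r \<noteq> 0" for r by (simp add: c_def)
    have cS: "c (Suc r) = c r * (- 1 / (2 * sqrt pi * sqrt (Suc r)))"
      by (simp add: c_def real_sqrt_mult)
    have "((\<lambda>t. hfun r t * exp (- pi * t\<^sup>2) / c r) has_real_derivative
        ((2 * pi * t * hfun r t - 2 * sqrt pi * sqrt (Suc r) * hfun (Suc r) t) * exp (- pi * t\<^sup>2)
          + hfun r t * (exp (- pi * t\<^sup>2) * (- 2 * pi * t))) / c r) (at t)" for t
      using c by (auto intro!: derivative_eq_intros hfun_deriv_raise)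
    then have "deriv (\<lambda>t. hfun r t * exp (- pi * t\<^sup>2) / c r)
        = (\<lambda>t. (- 2 * sqrt pi * sqrt (Suc r) * hfun (Suc r) t * exp (- pi * t\<^sup>2)) / c r)"
      by (intro ext DERIV_imp_deriv) (simp add: algebra_simps)
    also have "\<dots> = (\<lambda>t. hfun (Suc r) t * exp (- pi * t\<^sup>2) / c (Suc r))"
      using c by (simp add: cS fun_eq_iff field_simps)
    finally show ?case using Suc by (simp add: c_def)
  qed
  show ?thesis
    unfolding hermite_def rodrigues by (simp add: exp_minus)
qed

subsection \<open>Gaussian decay\<close>

text \<open>Quantifying over all powers \<open>m\<close> makes the class stable under multiplication
  by a coordinate, which only consumes one power. The rate 1 lies strictly below both
  \<open>pi\<close> and \<open>pi / 2\<close>, the rates of the window and of its transform.\<close>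

definition gauss_decay :: "('a::real_normed_vector \<Rightarrow> complex) \<Rightarrow> bool" where
  "gauss_decay F \<longleftrightarrow> (\<forall>m. \<exists>C. \<forall>x. norm x ^ m * cmod (F x) \<le> C * exp (- (norm x)\<^sup>2))"

lemma gauss_decayD:
  assumes "gauss_decay F"
  obtains C where "\<And>x. norm x ^ m * cmod (F x) \<le> C * exp (- (norm x)\<^sup>2)"
  using assms unfolding gauss_decay_def by metis

lemma gauss_decay_bound:
  assumes "gauss_decay F"
  obtains C where "0 \<le> C" "\<And>x. cmod (F x) \<le> C * exp (- (norm x)\<^sup>2)"
proof -
  obtain C where C: "\<And>x. cmod (F x) \<le> C * exp (- (norm x)\<^sup>2)"
    using gauss_decayD[OF assms, of 0] by auto
  have "0 \<le> C * exp (- (norm (0::'a))\<^sup>2)" by (rule order_trans[OF _ C]) simp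
  then show thesis using that C by simp
qed

lemma gauss_decay_mono:
  assumes F: "gauss_decay F" and G: "\<And>x. cmod (G x) \<le> A * norm x * cmod (F x)"
  shows "gauss_decay G"
  unfolding gauss_decay_def
proof
  fix m
  obtain C where C: "\<And>x. norm x ^ Suc m * cmod (F x) \<le> C * exp (- (norm x)\<^sup>2)"
    using gauss_decayD[OF F, of "Suc m"] by blast
  have "norm x ^ m * cmod (G x) \<le> (\<bar>A\<bar> * C) * exp (- (norm x)\<^sup>2)" for x
  proof -
    have "norm x ^ m * cmod (G x) \<le> norm x ^ m * (\<bar>A\<bar> * norm x * cmod (F x))"
      by (intro mult_left_mono order_trans[OF G] mult_right_mono) auto
    also have "\<dots> = \<bar>A\<bar> * (norm x ^ Suc m * cmod (F x))" by (simp add: mult_ac)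
    also have "\<dots> \<le> \<bar>A\<bar> * (C * exp (- (norm x)\<^sup>2))" by (intro mult_left_mono C) simp
    finally show ?thesis by (simp add: mult.assoc)
  qed
  then show "\<exists>C. \<forall>x. norm x ^ m * cmod (G x) \<le> C * exp (- (norm x)\<^sup>2)" by - (intro exI allI)
qed

lemma gauss_decay_cmult:
  assumes F: "gauss_decay F"
  shows "gauss_decay (\<lambda>x. c * F x)"
  unfolding gauss_decay_def
proof
  fix m
  obtain C where C: "\<And>x. norm x ^ m * cmod (F x) \<le> C * exp (- (norm x)\<^sup>2)"
    using gauss_decayD[OF F, of m] by blast
  have "norm x ^ m * cmod (c * F x) \<le> (cmod c * C) * exp (- (norm x)\<^sup>2)" for x
    using mult_left_mono[OF C[of x], of "cmod c"] by (simp add: norm_mult mult_ac)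
  then show "\<exists>C. \<forall>x. norm x ^ m * cmod (c * F x) \<le> C * exp (- (norm x)\<^sup>2)" by - (intro exI allI)
qed

lemma gauss_decay_add:
  assumes F: "gauss_decay F" and G: "gauss_decay G"
  shows "gauss_decay (\<lambda>x. F x + G x)"
  unfolding gauss_decay_def
proof
  fix m
  obtain C where C: "\<And>x. norm x ^ m * cmod (F x) \<le> C * exp (- (norm x)\<^sup>2)"
    using gauss_decayD[OF F, of m] by blast
  obtain D where D: "\<And>x. norm x ^ m * cmod (G x) \<le> D * exp (- (norm x)\<^sup>2)"
    using gauss_decayD[OF G, of m] by blast
  have "norm x ^ m * cmod (F x + G x) \<le> (C + D) * exp (- (norm x)\<^sup>2)" for x
  proof -
    have "norm x ^ m * cmod (F x + G x) \<le> norm x ^ m * (cmod (F x) + cmod (G x))"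
      by (intro mult_left_mono norm_triangle_ineq) simp
    then show ?thesis using C[of x] D[of x] by (simp add: algebra_simps)
  qed
  then show "\<exists>C. \<forall>x. norm x ^ m * cmod (F x + G x) \<le> C * exp (- (norm x)\<^sup>2)" by - (intro exI allI)
qed

lemma gauss_decay_diff: "gauss_decay F \<Longrightarrow> gauss_decay G \<Longrightarrow> gauss_decay (\<lambda>x. F x - G x)"
  using gauss_decay_add[of F "\<lambda>x. (- 1) * G x"] gauss_decay_cmult[of G "- 1"] by simp

text \<open>One term of the exponential series bounds the power by \<open>exp x\<close>, and
  completing the square bounds \<open>x\<close>. It lets the surplus in a Gaussian rate absorb any
  polynomial.\<close>

lemma power_le_exp:
  fixes x c :: real
  assumes x: "0 \<le> x" and c: "0 < c"
  shows "x ^ m \<le> fact m * exp (1 / (4 * c)) * exp (c * x\<^sup>2)"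
proof -
  have "x ^ m / fact m \<le> exp x"
  proof -
    have "(\<Sum>n\<in>{m}. x ^ n /\<^sub>R fact n) \<le> (\<Sum>n. x ^ n /\<^sub>R fact n)"
      using x exp_converges[of x] by (intro sum_le_suminf) (auto simp: sums_iff)
    then show ?thesis by (simp add: exp_def divide_inverse_commute)
  qed
  moreover have "x \<le> 1 / (4 * c) + c * x\<^sup>2"
  proof -
    have "0 \<le> (2 * c * x - 1)\<^sup>2 / (4 * c)" using c by simp
    also have "\<dots> = c * x\<^sup>2 - x + 1 / (4 * c)" using c by (simp add: field_simps power2_eq_square)
    finally show ?thesis by simp
  qed
  ultimately have "x ^ m / fact m \<le> exp (1 / (4 * c) + c * x\<^sup>2)"
    by (meson exp_le_cancel_iff order_trans)
  then show ?thesis by (simp add: exp_add field_simps)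
qed

lemma gauss_decay_gaussian:
  assumes a: "1 < a" and F: "\<And>x. cmod (F x) = C * exp (- a * (norm x)\<^sup>2)"
  shows "gauss_decay F"
  unfolding gauss_decay_def
proof
  fix m
  have C: "0 \<le> C" using F[of 0] by (metis mult_zero_right norm_ge_zero exp_zero mult.right_neutral norm_zero zero_power2)
  let ?D = "fact m * exp (1 / (4 * (a - 1)))"
  have "norm x ^ m * cmod (F x) \<le> (?D * C) * exp (- (norm x)\<^sup>2)" for x
  proof -
    have "norm x ^ m * cmod (F x) \<le> (?D * exp ((a - 1) * (norm x)\<^sup>2)) * (C * exp (- a * (norm x)\<^sup>2))"
      unfolding F using a C by (intro mult_right_mono power_le_exp) auto
    also have "\<dots> = ?D * C * exp ((a - 1) * (norm x)\<^sup>2 + (- a * (norm x)\<^sup>2))"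
      unfolding exp_add by (simp only: mult_ac)
    also have "(a - 1) * (norm x)\<^sup>2 + (- a * (norm x)\<^sup>2) = - (norm x)\<^sup>2" by (simp add: algebra_simps)
    finally show ?thesis .
  qed
  then show "\<exists>C. \<forall>x. norm x ^ m * cmod (F x) \<le> C * exp (- (norm x)\<^sup>2)" by - (intro exI allI)
qed

lemma gauss_decay_hfun: "gauss_decay (\<lambda>t. complex_of_real (hfun r t))"
proof (induction r rule: less_induct)
  case (less r)
  consider "r = 0" | s where "r = Suc s" by (cases r) auto
  then show ?case
  proof cases
    case 1
    then show ?thesis using pi_gt3
      by (intro gauss_decay_gaussian[of pi _ "2 powr (1/4)"]) (auto simp: norm_mult)
  next
    case (2 s)
    have A: "gauss_decay (\<lambda>t. complex_of_real t * complex_of_real (hfun s t))"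
    proof (rule gauss_decay_mono)
      show "gauss_decay (\<lambda>t. complex_of_real (hfun s t))" by (rule less) (simp add: 2)
      show "cmod (complex_of_real t * complex_of_real (hfun s t)) \<le> 1 * norm t * cmod (complex_of_real (hfun s t))" for t
        by (simp add: norm_mult)
    qed
    have B: "gauss_decay (\<lambda>t. complex_of_real (sqrt s) * complex_of_real (hfun (s - 1) t))"
      by (intro gauss_decay_cmult less) (simp add: 2)
    have dec: "gauss_decay (\<lambda>t. complex_of_real (1 / sqrt (Suc s)) * (complex_of_real (2 * sqrt pi) * (complex_of_real t * complex_of_real (hfun s t))
        - complex_of_real (sqrt s) * complex_of_real (hfun (s - 1) t)))"
      by (rule gauss_decay_cmult[OF gauss_decay_diff[OF gauss_decay_cmult[OF A] B]])
    have "(\<lambda>t. complex_of_real (hfun r t))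
      = (\<lambda>t. complex_of_real (1 / sqrt (Suc s)) * (complex_of_real (2 * sqrt pi) * (complex_of_real t * complex_of_real (hfun s t))
        - complex_of_real (sqrt s) * complex_of_real (hfun (s - 1) t)))"
      unfolding 2 hfun.simps(2) by (simp add: mult_ac fun_eq_iff)
    then show ?thesis using dec by (simp only:)
  qed
qed

subsection \<open>Matrix coefficients of the Hermite functions\<close>

text \<open>Common source of the reproducing kernel (equal indices) and of the transforms
  (\<open>z' = 0\<close>). Integration by parts changes the two indices separately, so neither
  special case is closed under it.\<close>

definition hker :: "nat \<Rightarrow> nat \<Rightarrow> phase \<Rightarrow> phase \<Rightarrow> complex" where
  "hker r s z z' = (LINT t|lborel. tfshift z' (hermite s) t * cnj (tfshift z (hermite r) t))"

definition zeta :: "phase \<Rightarrow> complex" where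
  "zeta z = Complex (fst z) (snd z)"

lemma zeta_zero [simp]: "zeta 0 = 0"
  by (simp add: zeta_def complex_eq_iff)

lemma norm_zeta: "cmod (zeta z) = norm z"
  by (simp add: zeta_def complex_norm norm_prod_def)

lemma continuous_zeta [continuous_intros]: "continuous_on S f \<Longrightarrow> continuous_on S (\<lambda>x. zeta (f x))"
  unfolding zeta_def by (auto simp: Complex_eq intro!: continuous_intros)

lemma rkernel_hermite: "rkernel (hermite r) = hker r r"
  by (simp add: fun_eq_iff rkernel_def hker_def)

lemma stft_hermite: "stft (hermite r) (hermite k) z = hker r k z 0"
  by (simp add: stft_def hker_def tfshift_def)

lemma hker_cnj: "cnj (hker r s z z') = hker s r z' z"
proof -
  have "cnj (hker r s z z') = (LINT t|lborel. cnj (tfshift z' (hermite s) t * cnj (tfshift z (hermite r) t)))"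
    unfolding hker_def by (rule Bochner_Integration.integral_cnj[symmetric])
  then show ?thesis by (simp add: hker_def mult.commute)
qed

lemma tfshift_hermite: "tfshift z (hermite r) t = exp (2 * pi * \<i> * complex_of_real (snd z) * t) * hfun r (t - fst z)"
  by (simp add: tfshift_def hermite_eq mult.assoc)

lemma continuous_tfshift_hermite: "continuous_on UNIV (tfshift z (hermite r))"
  unfolding tfshift_hermite[abs_def] by (intro continuous_intros)

lemma tfshift_hermite_bound:
  obtains C where "0 \<le> C" "\<And>t. cmod (tfshift z (hermite r) t) \<le> C * exp (- (t - fst z)\<^sup>2)"
proof -
  obtain C where C: "0 \<le> C" "\<And>t. cmod (complex_of_real (hfun r t)) \<le> C * exp (- (norm t)\<^sup>2)"
    using gauss_decay_bound[OF gauss_decay_hfun[of r]] by blast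
  have e: "cmod (exp (2 * pi * \<i> * complex_of_real (snd z) * t)) = 1" for t :: real
    using norm_exp_i_times[of "2 * pi * snd z * t"] by (simp add: mult_ac)
  have "cmod (tfshift z (hermite r) t) \<le> C * exp (- (t - fst z)\<^sup>2)" for t
    using C(2)[of "t - fst z"] unfolding tfshift_hermite norm_mult e by simp
  then show thesis by (rule that[OF C(1)])
qed

lemma integrable_gaussian_shift: "integrable lborel (\<lambda>t. exp (- (t - a)\<^sup>2) :: real)"
proof -
  have "integrable lborel (\<lambda>t. sqrt pi * normal_density a (sqrt (1/2)) t)"
    by (intro integrable_mult_right integrable_normal_density) simp
  then show ?thesis by (simp add: normal_density_def)
qed

lemma tfshift_product_bound:
  obtains C where "0 \<le> C"
    "\<And>t. cmod (tfshift z' (hermite s) t * cnj (tfshift z (hermite r) t)) \<le> C * exp (- (t - fst z')\<^sup>2)"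
proof -
  obtain C where C: "0 \<le> C" "\<And>t. cmod (tfshift z' (hermite s) t) \<le> C * exp (- (t - fst z')\<^sup>2)"
    using tfshift_hermite_bound[of z' s] by blast
  obtain D where D: "0 \<le> D" "\<And>t. cmod (tfshift z (hermite r) t) \<le> D * exp (- (t - fst z)\<^sup>2)"
    using tfshift_hermite_bound[of z r] by blast
  have D': "cmod (tfshift z (hermite r) t) \<le> D" for t
    by (rule order_trans[OF D(2)]) (simp add: D(1) mult_left_le)
  have "cmod (tfshift z' (hermite s) t * cnj (tfshift z (hermite r) t)) \<le> (C * D) * exp (- (t - fst z')\<^sup>2)" for t
    using mult_mono[OF C(2)[of t] D'[of t]] C(1) by (simp add: norm_mult mult_ac)
  then show thesis by (rule that[OF mult_nonneg_nonneg[OF C(1) D(1)]])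
qed

lemma continuous_tfshift_product:
  "continuous_on UNIV (\<lambda>t. tfshift z' (hermite s) t * cnj (tfshift z (hermite r) t))"
  by (intro continuous_on_mult continuous_on_cnj continuous_tfshift_hermite)

lemma tfshift_product_integrable:
  "integrable lborel (\<lambda>t. tfshift z' (hermite s) t * cnj (tfshift z (hermite r) t))"
proof -
  obtain C where C: "0 \<le> C"
    "\<And>t. cmod (tfshift z' (hermite s) t * cnj (tfshift z (hermite r) t)) \<le> C * exp (- (t - fst z')\<^sup>2)"
    using tfshift_product_bound[of z' s z r] by blast
  show ?thesis
  proof (rule Bochner_Integration.integrable_bound)
    show "integrable lborel (\<lambda>t. C * exp (- (t - fst z')\<^sup>2))"
      by (intro integrable_mult_right integrable_gaussian_shift)
    show "(\<lambda>t. tfshift z' (hermite s) t * cnj (tfshift z (hermite r) t)) \<in> borel_measurable lborel"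
      using borel_measurable_continuous_onI[OF continuous_tfshift_product] by simp
  qed (use C in auto)
qed

lemma tendsto_gaussian_shift: "((\<lambda>t. exp (- (t - a)\<^sup>2) :: real) \<longlongrightarrow> 0) at_infinity"
proof (rule Lim_null_comparison)
  have "\<bar>y\<bar> \<le> exp (y\<^sup>2)" for y :: real
  proof -
    have "\<bar>y\<bar> \<le> 1 + y\<^sup>2"
      using zero_le_power2[of "\<bar>y\<bar> - 1"] abs_ge_zero[of y] unfolding power2_diff power2_abs power_one by linarith
    then show ?thesis using exp_ge_add_one_self[of "y\<^sup>2"] by linarith
  qed
  then have "exp (- (t - a)\<^sup>2) \<le> inverse \<bar>t - a\<bar>" if "t \<noteq> a" for t
    using that by (simp add: exp_minus le_imp_inverse_le)
  moreover have "\<forall>\<^sub>F t in at_infinity. t \<noteq> a"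
    unfolding eventually_at_infinity by (rule exI[of _ "\<bar>a\<bar> + 1"]) auto
  ultimately show "\<forall>\<^sub>F t in at_infinity. norm (exp (- (t - a)\<^sup>2)) \<le> inverse \<bar>t - a\<bar>"
    by (auto elim!: eventually_mono)
  have "filterlim (\<lambda>t. t - a) at_infinity (at_infinity :: real filter)"
    using tendsto_add_filterlim_at_infinity[OF tendsto_const[of "- a"] filterlim_ident] by simp
  then have "((\<lambda>t. inverse (t - a)) \<longlongrightarrow> 0) at_infinity"
    by (rule filterlim_compose[OF tendsto_inverse_0])
  then show "((\<lambda>t. inverse \<bar>t - a\<bar>) \<longlongrightarrow> 0) at_infinity"
    by (subst (asm) tendsto_rabs_zero_iff[symmetric]) simp
qed

lemma integral_derivative_eq_0:
  fixes G g :: "real \<Rightarrow> complex"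
  assumes G: "\<And>t. (G has_vector_derivative g t) (at t)" and cont: "continuous_on UNIV g"
    and int: "integrable lborel g" and lim: "(G \<longlongrightarrow> 0) at_infinity"
  shows "(LINT t|lborel. g t) = 0"
proof -
  have "(LBINT t=-\<infinity>..\<infinity>. g t) = 0 - 0"
  proof (rule interval_integral_FTC_integrable[where F = G])
    show "isCont g t" for t using cont by (simp add: continuous_on_eq_continuous_at)
    show "set_integrable lborel (einterval (-\<infinity>) \<infinity>) g"
      using int by (simp add: set_integrable_def einterval_eq)
    show "((G \<circ> real_of_ereal) \<longlongrightarrow> 0) (at_right (-\<infinity>))"
      unfolding ereal_tendsto_simps by (rule tendsto_mono[OF at_bot_le_at_infinity lim])
    show "((G \<circ> real_of_ereal) \<longlongrightarrow> 0) (at_left \<infinity>)"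
      unfolding ereal_tendsto_simps by (rule tendsto_mono[OF at_top_le_at_infinity lim])
  qed (use G in auto)
  then show ?thesis
    by (simp add: interval_lebesgue_integral_def set_lebesgue_integral_def einterval_eq)
qed

lemma tfshift_hermite_deriv:
  assumes d: "(hfun r has_real_derivative d) (at (t - fst z))"
  shows "(tfshift z (hermite r) has_vector_derivative
     2 * pi * \<i> * complex_of_real (snd z) * tfshift z (hermite r) t + exp (2 * pi * \<i> * complex_of_real (snd z) * t) * d) (at t)"
proof -
  have 1: "((\<lambda>t. exp (2 * pi * \<i> * complex_of_real (snd z) * complex_of_real t)) has_vector_derivative
      2 * pi * \<i> * complex_of_real (snd z) * exp (2 * pi * \<i> * complex_of_real (snd z) * t)) (at t)"
    by (rule has_vector_derivative_real_field[where f = "\<lambda>u. exp (2 * pi * \<i> * complex_of_real (snd z) * u)"])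
       (auto intro!: derivative_eq_intros)
  have "((\<lambda>t. hfun r (t - fst z)) has_real_derivative d * 1) (at t)"
    by (rule DERIV_chain2[where f = "hfun r" and g = "\<lambda>t. t - fst z", OF d]) (auto intro!: derivative_eq_intros)
  then have 2: "((\<lambda>t. complex_of_real (hfun r (t - fst z))) has_vector_derivative of_real d) (at t)"
    by (intro has_vector_derivative_of_real) (simp add: has_real_derivative_iff_has_vector_derivative)
  show ?thesis
    using has_vector_derivative_mult[OF 1 2] unfolding tfshift_hermite[abs_def]
    by (simp add: add.commute mult_ac)
qed

text \<open>Modulation contributes \<open>2 * pi * \<i> * snd z\<close> and translation
  \<open>2 * pi * fst z\<close>; together they form the complex coordinate \<open>zeta z\<close>. In
  the raising form the second sign flips and the conjugate appears.\<close>

lemma tfshift_hermite_lower: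
  "(tfshift z (hermite r) has_vector_derivative
     2 * pi * zeta z * tfshift z (hermite r) t - 2 * pi * t * tfshift z (hermite r) t
       + 2 * sqrt pi * sqrt r * tfshift z (hermite (r - 1)) t) (at t)"
proof -
  have "2 * pi * \<i> * complex_of_real (snd z) * tfshift z (hermite r) t
      + exp (2 * pi * \<i> * complex_of_real (snd z) * t) * complex_of_real (2 * sqrt pi * sqrt r * hfun (r - 1) (t - fst z) - 2 * pi * (t - fst z) * hfun r (t - fst z))
    = 2 * pi * zeta z * tfshift z (hermite r) t - 2 * pi * t * tfshift z (hermite r) t
       + 2 * sqrt pi * sqrt r * tfshift z (hermite (r - 1)) t"
    unfolding tfshift_hermite zeta_def Complex_eq by (simp add: algebra_simps)
  then show ?thesis
    using tfshift_hermite_deriv[OF hfun_deriv_lower, of z r t] by (simp only:)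
qed

lemma tfshift_hermite_raise:
  "(tfshift z (hermite r) has_vector_derivative
     - 2 * pi * cnj (zeta z) * tfshift z (hermite r) t + 2 * pi * t * tfshift z (hermite r) t
       - 2 * sqrt pi * sqrt (Suc r) * tfshift z (hermite (Suc r)) t) (at t)"
proof -
  have "2 * pi * \<i> * complex_of_real (snd z) * tfshift z (hermite r) t
      + exp (2 * pi * \<i> * complex_of_real (snd z) * t) * complex_of_real (2 * pi * (t - fst z) * hfun r (t - fst z) - 2 * sqrt pi * sqrt (Suc r) * hfun (Suc r) (t - fst z))
    = - 2 * pi * cnj (zeta z) * tfshift z (hermite r) t + 2 * pi * t * tfshift z (hermite r) t
       - 2 * sqrt pi * sqrt (Suc r) * tfshift z (hermite (Suc r)) t"
    unfolding tfshift_hermite zeta_def Complex_eq by (simp add: algebra_simps del: of_nat_Suc)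
  then show ?thesis
    using tfshift_hermite_deriv[OF hfun_deriv_raise, of z r t] by (simp only:)
qed

text \<open>Integration by parts; the terms containing the factor \<open>t\<close> cancel.\<close>

lemma hker_raise_left:
  "sqrt (Suc r) * hker (Suc r) s z z' = sqrt s * hker r (s - 1) z z' + sqrt pi * (zeta z' - zeta z) * hker r s z z'"
proof -
  define A where "A s t = tfshift z' (hermite s) t" for s t
  define B where "B r t = cnj (tfshift z (hermite r) t)" for r t
  have int: "integrable lborel (\<lambda>t. c * (A s t * B r t))" for r s c
    unfolding A_def B_def by (intro integrable_mult_right tfshift_product_integrable)
  have cont: "continuous_on UNIV (\<lambda>t. c * (A s t * B r t))" for r s c
    unfolding A_def B_def by (intro continuous_on_mult_left continuous_tfshift_product)
  have I: "(LINT t|lborel. c * (A s t * B r t)) = c * hker r s z z'" for r s c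
    unfolding A_def B_def hker_def by (rule integral_mult_right_zero)
  define c1 c2 c3 where "c1 = 2 * pi * (zeta z' - zeta z)"
    and "c2 = complex_of_real (2 * sqrt pi * sqrt s)" and "c3 = complex_of_real (2 * sqrt pi * sqrt (Suc r))"
  define g where "g t = c1 * (A s t * B r t) + c2 * (A (s - 1) t * B r t) - c3 * (A s t * B (Suc r) t)" for t
  have "(LINT t|lborel. g t) = 0"
  proof (rule integral_derivative_eq_0)
    show "((\<lambda>t. A s t * B r t) has_vector_derivative g t) (at t)" for t
    proof -
      have "((\<lambda>t. A s t * B r t) has_vector_derivative
         A s t * cnj (- 2 * pi * cnj (zeta z) * tfshift z (hermite r) t + 2 * pi * t * tfshift z (hermite r) t
           - 2 * sqrt pi * sqrt (Suc r) * tfshift z (hermite (Suc r)) t)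
         + (2 * pi * zeta z' * A s t - 2 * pi * t * A s t + 2 * sqrt pi * sqrt s * A (s - 1) t) * B r t) (at t)"
        unfolding A_def B_def
        by (intro has_vector_derivative_mult has_vector_derivative_cnj tfshift_hermite_lower tfshift_hermite_raise)
      moreover have "A s t * cnj (- 2 * pi * cnj (zeta z) * tfshift z (hermite r) t + 2 * pi * t * tfshift z (hermite r) t
           - 2 * sqrt pi * sqrt (Suc r) * tfshift z (hermite (Suc r)) t)
         + (2 * pi * zeta z' * A s t - 2 * pi * t * A s t + 2 * sqrt pi * sqrt s * A (s - 1) t) * B r t = g t"
        unfolding g_def B_def c1_def c2_def c3_def by (simp add: algebra_simps del: of_nat_Suc)
      ultimately show ?thesis by (simp only:)
    qed
    show "continuous_on UNIV g"
      unfolding g_def[abs_def] by (intro continuous_on_add continuous_on_diff cont)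
    show "integrable lborel g"
      unfolding g_def[abs_def] by (intro Bochner_Integration.integrable_add Bochner_Integration.integrable_diff int)
    obtain C where C: "0 \<le> C" "\<And>t. cmod (A s t * B r t) \<le> C * exp (- (t - fst z')\<^sup>2)"
      using tfshift_product_bound[of z' s z r] unfolding A_def B_def by blast
    show "((\<lambda>t. A s t * B r t) \<longlongrightarrow> 0) at_infinity"
      by (rule Lim_null_comparison[OF always_eventually tendsto_mult_right_zero[OF tendsto_gaussian_shift]])
         (use C in blast)
  qed
  moreover have "(LINT t|lborel. g t) = c1 * hker r s z z' + c2 * hker r (s - 1) z z' - c3 * hker (Suc r) s z z'"
    unfolding g_def
    by (subst Bochner_Integration.integral_diff[OF Bochner_Integration.integrable_add[OF int int] int],
        subst Bochner_Integration.integral_add[OF int int]) (simp only: I)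
  ultimately have "c3 * hker (Suc r) s z z' = c2 * hker r (s - 1) z z' + c1 * hker r s z z'"
    by (simp add: algebra_simps)
  moreover have "complex_of_real pi = complex_of_real (sqrt pi) * complex_of_real (sqrt pi)"
    by (simp flip: of_real_mult)
  ultimately have "2 * complex_of_real (sqrt pi) * (sqrt (Suc r) * hker (Suc r) s z z')
     = 2 * complex_of_real (sqrt pi) * (sqrt s * hker r (s - 1) z z' + sqrt pi * (zeta z' - zeta z) * hker r s z z')"
    unfolding c1_def c2_def c3_def by (simp add: algebra_simps del: of_nat_Suc)
  then show ?thesis by (subst (asm) mult_cancel_left) auto
qed

lemma hker_raise_right:
  "sqrt (Suc s) * hker r (Suc s) z z' = sqrt r * hker (r - 1) s z z' + sqrt pi * (cnj (zeta z) - cnj (zeta z')) * hker r s z z'"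
proof -
  have "cnj (sqrt (Suc s) * hker (Suc s) r z' z)
      = cnj (sqrt r * hker s (r - 1) z' z + sqrt pi * (zeta z - zeta z') * hker s r z' z)"
    by (simp only: hker_raise_left)
  then show ?thesis by (simp add: hker_cnj del: of_nat_Suc)
qed

section \<open>The Gaussian kernel and the ladder relations of the coefficients\<close>

definition gauss :: "phase \<Rightarrow> complex" where
  "gauss z = exp (- (pi * \<i> * complex_of_real (fst z) * complex_of_real (snd z)) - pi / 2 * (norm z)\<^sup>2)"

text \<open>The Bargmann-Fock kernel, twisted by \<open>gauss\<close>, which is the transform of the
  Gaussian itself. The integral is the characteristic function of a normal distribution.\<close>

lemma hker_0_0: "hker 0 0 z z' = gauss z * cnj (gauss z') * exp (pi * cnj (zeta z) * zeta z')"
proof -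
  obtain x \<xi> where z: "z = (x, \<xi>)" by (cases z)
  obtain x' \<xi>' where z': "z' = (x', \<xi>')" by (cases z')
  \<comment> \<open>Centring at the midpoint \<open>m\<close> decouples the two Gaussians, and the
    scale \<open>c\<close> turns the exponent \<open>- 2 * pi * (c * u)\<^sup>2\<close> into
    \<open>- u\<^sup>2 / 2\<close>.\<close>
  define m where "m = (x + x') / 2"
  define \<omega> where "\<omega> = \<xi>' - \<xi>"
  define c where "c = 1 / (2 * sqrt pi)"
  define E where "E = exp (2 * pi * \<i> * \<omega> * m) * complex_of_real (exp (- (pi / 2 * (x - x')\<^sup>2)))"
  have c: "c > 0" "c\<^sup>2 = 1 / (4 * pi)" by (simp_all add: c_def power_divide power_mult_distrib)
  have integrand: "tfshift z' (hermite 0) (m + c * u) * cnj (tfshift z (hermite 0) (m + c * u))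
      = (2 * sqrt pi * E) * (std_normal_density u * iexp (sqrt pi * \<omega> * u))" for u
  proof -
    have a: "complex_of_real (2 powr (1/4)) * complex_of_real (2 powr (1/4)) = complex_of_real (sqrt 2)"
      by (simp add: powr_half_sqrt flip: of_real_mult powr_add)
    have quad: "- pi * (m + c * u - x')\<^sup>2 + - pi * (m + c * u - x)\<^sup>2 = - u\<^sup>2 / 2 + (- (pi / 2 * (x - x')\<^sup>2))"
    proof -
      have "(m + c * u - x')\<^sup>2 + (m + c * u - x)\<^sup>2 = 2 * (c\<^sup>2 * u\<^sup>2) + (x - x')\<^sup>2 / 2"
        by (simp add: m_def power2_eq_square field_simps)
      also have "c\<^sup>2 * u\<^sup>2 = u\<^sup>2 / (4 * pi)" unfolding c by simp
      finally have "pi * ((m + c * u - x')\<^sup>2 + (m + c * u - x)\<^sup>2) = u\<^sup>2 / 2 + pi / 2 * (x - x')\<^sup>2"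
        by (simp add: field_simps)
      then show ?thesis by (simp add: algebra_simps)
    qed
    have lin: "2 * pi * \<i> * \<xi>' * complex_of_real (m + c * u) + cnj (2 * pi * \<i> * \<xi> * complex_of_real (m + c * u))
       = 2 * pi * \<i> * \<omega> * m + \<i> * complex_of_real (sqrt pi * \<omega> * u)"
    proof -
      have "2 * pi * c = sqrt pi" unfolding c_def by (simp add: real_div_sqrt)
      then have spi: "complex_of_real (sqrt pi) = 2 * complex_of_real pi * complex_of_real c"
        by (simp flip: of_real_mult add: of_real_mult[of 2, symmetric, simplified])
      show ?thesis unfolding of_real_mult spi by (simp add: \<omega>_def algebra_simps)
    qed
    have "tfshift z' (hermite 0) (m + c * u) * cnj (tfshift z (hermite 0) (m + c * u))
       = (complex_of_real (2 powr (1/4)) * complex_of_real (2 powr (1/4)))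
         * exp (2 * pi * \<i> * \<xi>' * complex_of_real (m + c * u) + cnj (2 * pi * \<i> * \<xi> * complex_of_real (m + c * u)))
         * complex_of_real (exp (- pi * (m + c * u - x')\<^sup>2 + - pi * (m + c * u - x)\<^sup>2))"
      unfolding exp_add of_real_mult tfshift_hermite z z' hfun.simps(1)
      by (simp add: exp_cnj mult_ac)
    also have "\<dots> = sqrt 2 * (exp (2 * pi * \<i> * \<omega> * m) * iexp (sqrt pi * \<omega> * u))
         * (complex_of_real (exp (- u\<^sup>2 / 2)) * complex_of_real (exp (- (pi / 2 * (x - x')\<^sup>2))))"
      unfolding a quad lin by (simp only: exp_add of_real_mult)
    also have "sqrt 2 = 2 * sqrt pi * (1 / sqrt (2 * pi))"
      by (simp add: real_sqrt_mult real_div_sqrt)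
    finally show ?thesis
      unfolding E_def std_normal_density_def by (simp add: mult_ac)
  qed
  have ch: "(LINT u|lborel. std_normal_density u * iexp (s * u)) = exp (- s\<^sup>2 / 2)" for s :: real
  proof -
    have "(CLINT u|std_normal_distribution. iexp (s * u)) = complex_of_real (exp (- s\<^sup>2 / 2))"
      using fun_cong[OF char_std_normal_distribution, of s] by (simp add: char_def)
    then show ?thesis
      by (subst (asm) integral_density) (auto simp: scaleR_conv_of_real)
  qed
  have "hker 0 0 z z' = \<bar>c\<bar> *\<^sub>R (LINT u|lborel. tfshift z' (hermite 0) (m + c * u) * cnj (tfshift z (hermite 0) (m + c * u)))"
    unfolding hker_def using c by (intro lborel_integral_real_affine) simp
  also have "\<dots> = c * (2 * sqrt pi * E) * exp (- (sqrt pi * \<omega>)\<^sup>2 / 2)"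
    unfolding integrand using c ch[of "sqrt pi * \<omega>"] by (simp add: scaleR_conv_of_real)
  also have "\<dots> = E * complex_of_real (exp (- (pi / 2 * \<omega>\<^sup>2)))"
    by (simp add: c_def power_mult_distrib)
  also have "\<dots> = exp (2 * pi * \<i> * \<omega> * m + complex_of_real (- (pi / 2 * (x - x')\<^sup>2)) + complex_of_real (- (pi / 2 * \<omega>\<^sup>2)))"
    unfolding E_def exp_add exp_of_real ..
  also have "2 * pi * \<i> * \<omega> * m + complex_of_real (- (pi / 2 * (x - x')\<^sup>2)) + complex_of_real (- (pi / 2 * \<omega>\<^sup>2))
     = (- (pi * \<i> * x * \<xi>) - pi / 2 * (norm z)\<^sup>2) + cnj (- (pi * \<i> * x' * \<xi>') - pi / 2 * (norm z')\<^sup>2)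
       + pi * cnj (zeta z) * zeta z'"
    by (simp add: complex_eq_iff z z' norm_prod_def zeta_def m_def \<omega>_def power2_eq_square field_simps)
  also have "exp \<dots> = gauss z * cnj (gauss z') * exp (pi * cnj (zeta z) * zeta z')"
    unfolding gauss_def exp_add exp_cnj[symmetric] z z' by simp
  finally show ?thesis .
qed

text \<open>The \<open>w\<^sub>k\<close> of the overview, with the window index still free.\<close>

definition hw :: "nat \<Rightarrow> nat \<Rightarrow> phase \<Rightarrow> complex" where
  "hw r k z = hker r k z 0"

lemma hw_raise_left:
  "sqrt (Suc r) * hw (Suc r) k z = sqrt k * hw r (k - 1) z - sqrt pi * zeta z * hw r k z"
  using hker_raise_left[of r k z 0] by (simp add: hw_def algebra_simps del: of_nat_Suc)

lemma hw_raise_right: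
  "sqrt (Suc k) * hw r (Suc k) z = sqrt r * hw (r - 1) k z + sqrt pi * cnj (zeta z) * hw r k z"
  using hker_raise_right[of k r z 0] by (simp add: hw_def algebra_simps del: of_nat_Suc)

lemma sqrt_Suc_nonzero: "complex_of_real (sqrt (Suc n)) \<noteq> 0"
  by simp

lemma hw_Suc_left:
  "hw (Suc r) k z = 1 / sqrt (Suc r) * (sqrt k * hw r (k - 1) z - sqrt pi * (zeta z * hw r k z))"
  using hw_raise_left[of r k z] sqrt_Suc_nonzero[of r] by (simp add: field_simps del: of_nat_Suc)

lemma hw_0_Suc: "hw 0 (Suc k) z = sqrt pi / sqrt (Suc k) * (cnj (zeta z) * hw 0 k z)"
  using hw_raise_right[of k 0 z] sqrt_Suc_nonzero[of k] by (simp add: field_simps del: of_nat_Suc)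

lemma hw_0_0: "hw 0 0 z = gauss z"
  by (simp add: hw_def hker_0_0 gauss_def)

lemma hw_0: "hw 0 k z = gauss z * (sqrt pi * cnj (zeta z)) ^ k / sqrt (fact k)"
proof (induction k)
  case 0
  show ?case by (simp add: hw_0_0)
next
  case (Suc k)
  have "complex_of_real (sqrt (fact (Suc k))) = sqrt (Suc k) * sqrt (fact k)"
    by (simp add: real_sqrt_mult)
  then show ?case unfolding hw_0_Suc Suc by (simp add: field_simps del: of_nat_Suc fact_Suc)
qed

text \<open>By the ladder relations every coefficient is a polynomial in \<open>zeta\<close> and its
  conjugate times \<open>gauss\<close>; this rule transfers regularity and decay from
  \<open>gauss\<close>.\<close>

lemma hw_induct:
  assumes gauss: "P gauss"
    and cmult: "\<And>F c. P F \<Longrightarrow> P (\<lambda>z. c * F z)"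
    and diff: "\<And>F G. P F \<Longrightarrow> P G \<Longrightarrow> P (\<lambda>z. F z - G z)"
    and zeta: "\<And>F. P F \<Longrightarrow> P (\<lambda>z. zeta z * F z)"
    and cnj_zeta: "\<And>F. P F \<Longrightarrow> P (\<lambda>z. cnj (zeta z) * F z)"
  shows "P (hw r k)"
proof -
  have 0: "P (hw 0 k)" for k
  proof (induction k)
    case 0
    have "hw 0 0 = gauss" by (simp add: fun_eq_iff hw_0_0)
    then show ?case using gauss by simp
  next
    case (Suc k)
    show ?case unfolding hw_0_Suc[abs_def] by (rule cmult[OF cnj_zeta[OF Suc]])
  qed
  have "\<forall>k. P (hw r k)"
  proof (induction r)
    case (Suc r)
    show ?case
    proof
      fix k
      show "P (hw (Suc r) k)" unfolding hw_Suc_left[abs_def]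
        by (rule cmult[OF diff[OF cmult[OF Suc[rule_format]] cmult[OF zeta[OF Suc[rule_format]]]]])
    qed
  qed (use 0 in simp)
  then show ?thesis by simp
qed

lemma continuous_hw: "continuous_on UNIV (hw r k)"
proof (rule hw_induct)
  show "continuous_on UNIV gauss"
    unfolding gauss_def[abs_def] by (intro continuous_intros)
qed (auto intro!: continuous_intros)

lemma hw_measurable [measurable]: "hw r k \<in> borel_measurable borel"
  by (rule borel_measurable_continuous_onI[OF continuous_hw])

lemma norm_gauss: "cmod (gauss z) = exp (- (pi / 2) * (norm z)\<^sup>2)"
  by (simp add: gauss_def)

lemma gauss_decay_hw: "gauss_decay (hw r k)"
proof (rule hw_induct)
  show "gauss_decay gauss" using pi_gt3
    by (intro gauss_decay_gaussian[of "pi / 2" _ 1]) (auto simp: norm_gauss)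
  show "gauss_decay (\<lambda>z. zeta z * F z)" if "gauss_decay F" for F
    by (rule gauss_decay_mono[OF that, of _ 1]) (simp add: norm_mult norm_zeta)
  show "gauss_decay (\<lambda>z. cnj (zeta z) * F z)" if "gauss_decay F" for F
    by (rule gauss_decay_mono[OF that, of _ 1]) (simp add: norm_mult norm_zeta)
qed (auto intro: gauss_decay_cmult gauss_decay_diff)

subsection \<open>The kernel as a series in the Hermite coefficients\<close>

text \<open>The series satisfies the same left recurrence as the kernel: raising \<open>r\<close>
  produces a term shifted in \<open>k\<close>, and the right recurrence for \<open>hw s\<close>
  moves that shift onto the index \<open>s\<close>.\<close>

lemma hker_sums_step:
  assumes rs: "(\<lambda>k. hw r k z * cnj (hw s k z')) sums hker r s z z'"
    and rs1: "s = 0 \<or> (\<lambda>k. hw r k z * cnj (hw (s - 1) k z')) sums hker r (s - 1) z z'"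
  shows "(\<lambda>k. hw (Suc r) k z * cnj (hw s k z')) sums hker (Suc r) s z z'"
proof -
  have rs1': "(\<lambda>k. sqrt s * (hw r k z * cnj (hw (s - 1) k z'))) sums (sqrt s * hker r (s - 1) z z')"
    using rs1 by (cases "s = 0") (auto intro: sums_mult)
  have "sqrt (Suc k) * hw r k z * cnj (hw s (Suc k) z')
      = sqrt s * (hw r k z * cnj (hw (s - 1) k z')) + sqrt pi * zeta z' * (hw r k z * cnj (hw s k z'))" for k
    using arg_cong[OF hw_raise_right[of k s z'], of "\<lambda>c. hw r k z * cnj c"]
    by (simp add: algebra_simps del: of_nat_Suc)
  then have "(\<lambda>k. sqrt (Suc k) * hw r k z * cnj (hw s (Suc k) z'))
      sums (sqrt s * hker r (s - 1) z z' + sqrt pi * zeta z' * hker r s z z')"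
    using sums_add[OF rs1' sums_mult[OF rs, of "sqrt pi * zeta z'"]] by simp
  \<comment> \<open>Reindexing by one changes nothing, as the new term at \<open>k = 0\<close>
    carries the factor \<open>sqrt 0\<close>.\<close>
  then have "(\<lambda>k. sqrt k * hw r (k - 1) z * cnj (hw s k z'))
      sums (sqrt s * hker r (s - 1) z z' + sqrt pi * zeta z' * hker r s z z')"
    by (subst (asm) sums_Suc_iff[of "\<lambda>k. sqrt k * hw r (k - 1) z * cnj (hw s k z')", unfolded diff_Suc_1])
       simp
  from sums_diff[OF this sums_mult[OF rs, of "sqrt pi * zeta z"]]
  have "(\<lambda>k. sqrt (Suc r) * hw (Suc r) k z * cnj (hw s k z')) sums (sqrt (Suc r) * hker (Suc r) s z z')"
    unfolding hw_raise_left hker_raise_left by (simp add: algebra_simps)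
  then have "(\<lambda>k. complex_of_real (1 / sqrt (Suc r)) * (sqrt (Suc r) * hw (Suc r) k z * cnj (hw s k z')))
      sums (complex_of_real (1 / sqrt (Suc r)) * (sqrt (Suc r) * hker (Suc r) s z z'))"
    by (rule sums_mult)
  then show ?thesis by (simp del: of_nat_Suc)
qed

lemma hker_sums_0_0: "(\<lambda>k. hw 0 k z * cnj (hw 0 k z')) sums hker 0 0 z z'"
proof -
  have "hw 0 k z * cnj (hw 0 k z') = gauss z * cnj (gauss z') * ((pi * cnj (zeta z) * zeta z') ^ k /\<^sub>R fact k)" for k
  proof -
    have "complex_of_real (sqrt (fact k)) * complex_of_real (sqrt (fact k)) = of_real (fact k)"
      by (simp flip: of_real_mult)
    moreover have "complex_of_real (sqrt pi) ^ k * complex_of_real (sqrt pi) ^ k = complex_of_real pi ^ k"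
      by (simp flip: power_mult_distrib of_real_mult)
    ultimately have "hw 0 k z * cnj (hw 0 k z')
      = gauss z * cnj (gauss z') * ((complex_of_real (sqrt pi) ^ k * complex_of_real (sqrt pi) ^ k) * cnj (zeta z) ^ k * zeta z' ^ k)
         / (complex_of_real (sqrt (fact k)) * complex_of_real (sqrt (fact k)))"
      unfolding hw_0 by (simp add: power_mult_distrib mult_ac)
    also have "\<dots> = gauss z * cnj (gauss z') * (complex_of_real pi ^ k * cnj (zeta z) ^ k * zeta z' ^ k) / of_real (fact k)"
      by (simp flip: power_mult_distrib of_real_mult)
    finally show ?thesis
      by (simp add: scaleR_conv_of_real power_mult_distrib field_simps)
  qed
  then show ?thesis
    unfolding hker_0_0 by (simp only:) (intro sums_mult exp_converges)
qed

text \<open>The step raises the left index only. Starting at the exponential series, raise it with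
  right index 0, exchange the two sides by hermitian symmetry, and raise again with an arbitrary
  right index.\<close>

lemma hker_sums: "(\<lambda>k. hw r k z * cnj (hw s k z')) sums hker r s z z'"
proof -
  have sym: "(\<lambda>k. hw s k z' * cnj (hw r k z)) sums hker s r z' z"
    if "(\<lambda>k. hw r k z * cnj (hw s k z')) sums hker r s z z'" for r s z z'
    using sums_cnj[THEN iffD2, OF that] by (simp add: hker_cnj mult.commute)
  have "\<forall>z z'. (\<lambda>k. hw s k z * cnj (hw 0 k z')) sums hker s 0 z z'" for s
    by (induction s) (auto intro: hker_sums_0_0 hker_sums_step)
  then have "\<forall>s z z'. (\<lambda>k. hw 0 k z * cnj (hw s k z')) sums hker 0 s z z'"
    using sym by blast
  then have "\<forall>s z z'. (\<lambda>k. hw r k z * cnj (hw s k z')) sums hker r s z z'"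
    by (induction r) (auto intro: hker_sums_step)
  then show ?thesis by blast
qed

text \<open>At equal points the coordinate terms drop out of both recurrences, so every entry is
  reached from the Gaussian one. This amounts to orthonormality of the Hermite functions.\<close>

lemma hker_diag: "hker r s z z = (if r = s then 1 else 0)"
proof -
  have "gauss z * cnj (gauss z) = complex_of_real (exp (- pi * (norm z)\<^sup>2))"
    unfolding mult_cnj_self norm_gauss by (simp flip: of_real_power exp_double)
  moreover have "exp (pi * cnj (zeta z) * zeta z) = complex_of_real (exp (pi * (norm z)\<^sup>2))"
  proof -
    have "pi * cnj (zeta z) * zeta z = complex_of_real (pi * (norm z)\<^sup>2)"
      using mult_cnj_self[of "zeta z"] by (simp add: norm_zeta mult_ac)
    then show ?thesis by (simp only: exp_of_real)
  qed
  ultimately have "hker 0 0 z z = complex_of_real (exp (- pi * (norm z)\<^sup>2) * exp (pi * (norm z)\<^sup>2))"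
    unfolding hker_0_0 by (simp only: of_real_mult)
  then have "hker 0 0 z z = 1" by (simp flip: exp_add)
  moreover have "hker 0 (Suc s) z z = 0" for s
    using hker_raise_right[of s 0 z z] by (simp del: of_nat_Suc)
  ultimately have 0: "hker 0 s z z = (if 0 = s then 1 else 0)" for s by (cases s) auto
  have "\<forall>s. hker r s z z = (if r = s then 1 else 0)"
  proof (induction r)
    case (Suc r)
    show ?case
    proof
      fix s
      have "sqrt (Suc r) * hker (Suc r) s z z = sqrt s * (if r = s - 1 then 1 else 0)"
        using hker_raise_left[of r s z z] Suc by simp
      then show "hker (Suc r) s z z = (if Suc r = s then 1 else 0)"
        by (cases s) (auto simp del: of_nat_Suc split: if_splits)
    qed
  qed (use 0 in simp)
  then show ?thesis by simp
qed

subsection \<open>Radial integrals and rotations of phase space\<close>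

lemma emeasure_cball_phase: "0 \<le> R \<Longrightarrow> emeasure lborel (cball (c :: phase) R) = ennreal (pi * R\<^sup>2)"
  by (subst emeasure_cball) (auto simp: unit_ball_vol_2 power2_eq_square)

text \<open>Replaces polar coordinates: the disk where \<open>c * (norm z)\<^sup>2\<close> is at
  most \<open>a\<close> has area \<open>pi / c * a\<close>, linear in \<open>a\<close>, so the image
  measure is a multiple of Lebesgue measure on the half-line.\<close>

lemma distr_radial:
  assumes c: "0 < c"
  shows "distr lborel borel (\<lambda>z :: phase. c * (norm z)\<^sup>2) = density lborel (\<lambda>t. ennreal (pi / c) * indicator {0..} t)"
    (is "?L = ?R")
proof (rule measure_eqI_generator_eq)
  let ?E = "range (atMost :: real \<Rightarrow> real set)"
  show "Int_stable ?E" by (auto simp: Int_stable_def)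
  show "?E \<subseteq> Pow UNIV" by simp
  show "sets ?L = sigma_sets UNIV ?E" "sets ?R = sigma_sets UNIV ?E"
    by (simp_all add: borel_eq_atMost)
  show "range (\<lambda>n. {..real n}) \<subseteq> ?E" by auto
  show "(\<Union>n. {..real n}) = UNIV" using real_arch_simple by auto
  have em: "emeasure ?L {..a} = ennreal (pi / c * max 0 a)" "emeasure ?R {..a} = ennreal (pi / c * max 0 a)" for a
  proof -
    have set: "(\<lambda>z :: phase. c * (norm z)\<^sup>2) -` {..a} = (if 0 \<le> a then cball 0 (sqrt (a / c)) else {})"
    proof (cases "0 \<le> a")
      case True
      have "c * (norm z)\<^sup>2 \<le> a \<longleftrightarrow> norm z \<le> sqrt (a / c)" for z :: phase
      proof -
        have "norm z \<le> sqrt (a / c) \<longleftrightarrow> (norm z)\<^sup>2 \<le> a / c"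
          using real_sqrt_le_iff[of "(norm z)\<^sup>2" "a / c"] by simp
        then show ?thesis using c by (simp add: field_simps)
      qed
      then show ?thesis using True by (simp add: set_eq_iff)
    next
      case False
      have "a < c * (norm z)\<^sup>2" for z :: phase
      proof -
        have "0 \<le> c * (norm z)\<^sup>2" using c by simp
        then show ?thesis using False by linarith
      qed
      then show ?thesis using False by (auto simp: not_le[symmetric])
    qed
    show "emeasure ?L {..a} = ennreal (pi / c * max 0 a)"
    proof (cases "0 \<le> a")
      case True
      then show ?thesis using c
        by (subst emeasure_distr) (auto simp: set emeasure_cball_phase max_def)
    qed (subst emeasure_distr, auto simp: set max_def)
    have "emeasure ?R {..a} = (\<integral>\<^sup>+t. ennreal (pi / c) * indicator {0..a} t \<partial>lborel)"
      by (subst emeasure_density) (auto simp: mult.assoc intro!: nn_integral_cong split: split_indicator)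
    also have "\<dots> = ennreal (pi / c * max 0 a)"
      using c by (subst nn_integral_cmult_indicator) (auto simp: max_def simp flip: ennreal_mult')
    finally show "emeasure ?R {..a} = ennreal (pi / c * max 0 a)" .
  qed
  show "emeasure ?L X = emeasure ?R X" if "X \<in> ?E" for X
    using that em by auto
  show "emeasure ?L {..real n} \<noteq> \<infinity>" for n by (simp add: em)
qed

lemma nn_integral_radial:
  assumes c: "0 < c" and f: "f \<in> borel_measurable borel"
  shows "(\<integral>\<^sup>+(z::phase). f (c * (norm z)\<^sup>2) \<partial>lborel) = ennreal (pi / c) * (\<integral>\<^sup>+t. f t * indicator {0..} t \<partial>lborel)"
proof -
  have "(\<integral>\<^sup>+(z::phase). f (c * (norm z)\<^sup>2) \<partial>lborel) = (\<integral>\<^sup>+t. f t \<partial>distr lborel borel (\<lambda>z :: phase. c * (norm z)\<^sup>2))"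
    using f by (subst nn_integral_distr) auto
  also have "\<dots> = (\<integral>\<^sup>+t. ennreal (pi / c) * indicator {0..} t * f t \<partial>lborel)"
    unfolding distr_radial[OF c] using f by (subst nn_integral_density) auto
  also have "\<dots> = ennreal (pi / c) * (\<integral>\<^sup>+t. f t * indicator {0..} t \<partial>lborel)"
    using f by (subst nn_integral_cmult[symmetric]) (auto simp: mult_ac)
  finally show ?thesis .
qed

lemma sq_int_gauss_decay:
  assumes F: "gauss_decay F" and cont: "continuous_on UNIV F"
  shows "sq_int F"
  unfolding sq_int_def
proof
  show m: "F \<in> borel_measurable lborel" using borel_measurable_continuous_onI[OF cont] by simp
  obtain C where C: "0 \<le> C" "\<And>z. cmod (F z) \<le> C * exp (- (norm z)\<^sup>2)"
    using gauss_decay_bound[OF F] by blast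
  show "integrable lborel (\<lambda>z. (cmod (F z))\<^sup>2)"
  proof (rule integrableI_bounded)
    show "(\<lambda>z. (cmod (F z))\<^sup>2) \<in> borel_measurable lborel" using m by measurable
    have "(\<integral>\<^sup>+z. ennreal (norm ((cmod (F z))\<^sup>2)) \<partial>lborel) \<le> (\<integral>\<^sup>+(z::phase). ennreal (C\<^sup>2) * ennreal (exp (- (2 * (norm z)\<^sup>2))) \<partial>lborel)"
    proof (intro nn_integral_mono)
      fix z
      have "(cmod (F z))\<^sup>2 \<le> (C * exp (- (norm z)\<^sup>2))\<^sup>2" by (intro power_mono C(2)) simp
      also have "\<dots> = C\<^sup>2 * exp (- (2 * (norm z)\<^sup>2))"
        by (simp add: power_mult_distrib flip: exp_double)
      finally show "ennreal (norm ((cmod (F z))\<^sup>2)) \<le> ennreal (C\<^sup>2) * ennreal (exp (- (2 * (norm z)\<^sup>2)))"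
        by (simp add: ennreal_leI flip: ennreal_mult)
    qed
    also have "\<dots> = ennreal (C\<^sup>2) * (\<integral>\<^sup>+(z::phase). ennreal (exp (- (2 * (norm z)\<^sup>2))) \<partial>lborel)"
      by (rule nn_integral_cmult) measurable
    also have "(\<integral>\<^sup>+(z::phase). ennreal (exp (- (2 * (norm z)\<^sup>2))) \<partial>lborel)
        = ennreal (pi / 2) * (\<integral>\<^sup>+t. ennreal (exp (- t)) * indicator {0..} t \<partial>lborel)"
      by (rule nn_integral_radial) auto
    also have "(\<integral>\<^sup>+(t::real). ennreal (exp (- t)) * indicator {0..} t \<partial>lborel) = 1"
      using nn_intergal_power_times_exp_Ici[of 0] by simp
    finally show "(\<integral>\<^sup>+z. ennreal (norm ((cmod (F z))\<^sup>2)) \<partial>lborel) < \<infinity>"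
      by (rule le_less_trans) (simp add: ennreal_mult_less_top)
  qed
qed

lemma hw_sq_int: "sq_int (hw r k)"
  by (rule sq_int_gauss_decay[OF gauss_decay_hw continuous_hw])

text \<open>In the variable \<open>pi * (norm z)\<^sup>2\<close> the density becomes the Gamma
  density with parameter \<open>k + 1\<close>.\<close>

lemma hw_0_l2_sq: "l2_sq (hw 0 k) = 1"
proof -
  have "(cmod (hw 0 k z))\<^sup>2 = (1 / fact k) * ((pi * (norm z)\<^sup>2) ^ k * exp (- (pi * (norm z)\<^sup>2)))" for z
  proof -
    have "(sqrt pi ^ k)\<^sup>2 = ((sqrt pi)\<^sup>2) ^ k"
      by (simp only: power_mult[symmetric] mult.commute)
    then have "(sqrt pi ^ k)\<^sup>2 = pi ^ k" by simp
    moreover have "((norm z) ^ k)\<^sup>2 = ((norm z)\<^sup>2) ^ k"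
      by (simp only: power_mult[symmetric] mult.commute)
    moreover have "(exp (- (pi / 2) * (norm z)\<^sup>2))\<^sup>2 = exp (- (pi * (norm z)\<^sup>2))"
      by (simp flip: exp_double)
    ultimately show ?thesis
      by (simp add: hw_0 norm_mult norm_divide norm_power norm_gauss norm_zeta power_mult_distrib power_divide)
  qed
  then have "ennreal (l2_sq (hw 0 k)) = (\<integral>\<^sup>+(z::phase). ennreal (1 / fact k) * ennreal ((pi * (norm z)\<^sup>2) ^ k * exp (- (pi * (norm z)\<^sup>2))) \<partial>lborel)"
    unfolding l2_sq_def using sq_int_integrable[OF hw_sq_int[of 0 k]]
    by (subst nn_integral_eq_integral[symmetric]) (auto simp flip: ennreal_mult)
  also have "\<dots> = ennreal (1 / fact k) * (\<integral>\<^sup>+(z::phase). ennreal ((pi * (norm z)\<^sup>2) ^ k * exp (- (pi * (norm z)\<^sup>2))) \<partial>lborel)"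
    by (rule nn_integral_cmult) measurable
  also have "(\<integral>\<^sup>+(z::phase). ennreal ((pi * (norm z)\<^sup>2) ^ k * exp (- (pi * (norm z)\<^sup>2))) \<partial>lborel)
      = ennreal (pi / pi) * (\<integral>\<^sup>+t. ennreal (t ^ k * exp (- t)) * indicator {0..} t \<partial>lborel)"
    by (rule nn_integral_radial) auto
  also have "(\<integral>\<^sup>+t. ennreal (t ^ k * exp (- t)) * indicator {0..} t \<partial>lborel) = ennreal (fact k)"
    using nn_intergal_power_times_exp_Ici[of k] by simp
  finally show ?thesis by (simp flip: ennreal_mult)
qed

section \<open>Shears and rotations preserve Lebesgue measure\<close>

lemma nn_integral_phase_fst:
  assumes "f \<in> borel_measurable (borel :: phase measure)"
  shows "(\<integral>\<^sup>+z. f z \<partial>lborel) = (\<integral>\<^sup>+y. \<integral>\<^sup>+x. f (x, y) \<partial>lborel \<partial>lborel)"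
  unfolding lborel_prod[symmetric] using assms
  by (intro lborel_pair.nn_integral_snd[symmetric]) (simp add: lborel_prod)

lemma nn_integral_phase_snd:
  assumes "f \<in> borel_measurable (borel :: phase measure)"
  shows "(\<integral>\<^sup>+z. f z \<partial>lborel) = (\<integral>\<^sup>+x. \<integral>\<^sup>+y. f (x, y) \<partial>lborel \<partial>lborel)"
  unfolding lborel_prod[symmetric] using assms
  by (intro lborel.nn_integral_fst[symmetric]) (simp add: lborel_prod)

lemma nn_integral_shift: "f \<in> borel_measurable borel \<Longrightarrow> (\<integral>\<^sup>+x. f (x + a) \<partial>lborel) = (\<integral>\<^sup>+(x::real). f x \<partial>lborel)"
  using nn_integral_real_affine[of f 1 a] by (simp add: add.commute)

lemma shear_measurable [measurable]:
  "(\<lambda>z :: phase. (fst z + a * snd z, snd z)) \<in> borel_measurable borel"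
  "(\<lambda>z :: phase. (fst z, snd z + a * fst z)) \<in> borel_measurable borel"
  by (intro borel_measurable_continuous_onI continuous_intros)+

text \<open>On each horizontal line a shear is a translation, so Fubini reduces the claim to one
  dimension.\<close>

lemma distr_shear_fst: "distr lborel borel (\<lambda>z :: phase. (fst z + a * snd z, snd z)) = lborel"
proof (rule measure_eqI)
  fix A assume "A \<in> sets (distr lborel borel (\<lambda>z :: phase. (fst z + a * snd z, snd z)))"
  then have [measurable]: "A \<in> sets borel" by simp
  have "emeasure (distr lborel borel (\<lambda>z :: phase. (fst z + a * snd z, snd z))) A
      = (\<integral>\<^sup>+z. indicator A (fst z + a * snd z, snd z) \<partial>lborel)"
    by (subst nn_integral_indicator[symmetric], simp, subst nn_integral_distr) auto
  also have "\<dots> = (\<integral>\<^sup>+y. \<integral>\<^sup>+x. indicator A (x + a * y, y) \<partial>lborel \<partial>lborel)"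
    by (subst nn_integral_phase_fst) auto
  also have "\<dots> = (\<integral>\<^sup>+y. \<integral>\<^sup>+x. indicator A (x, y) \<partial>lborel \<partial>lborel)"
    by (intro nn_integral_cong nn_integral_shift[where f = "\<lambda>x. indicator A (x, _)"]) measurable
  also have "\<dots> = emeasure lborel A"
    by (subst nn_integral_phase_fst[symmetric]) auto
  finally show "emeasure (distr lborel borel (\<lambda>z :: phase. (fst z + a * snd z, snd z))) A = emeasure lborel A" .
qed simp

lemma distr_shear_snd: "distr lborel borel (\<lambda>z :: phase. (fst z, snd z + a * fst z)) = lborel"
proof (rule measure_eqI)
  fix A assume "A \<in> sets (distr lborel borel (\<lambda>z :: phase. (fst z, snd z + a * fst z)))"
  then have [measurable]: "A \<in> sets borel" by simp
  have "emeasure (distr lborel borel (\<lambda>z :: phase. (fst z, snd z + a * fst z))) A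
      = (\<integral>\<^sup>+z. indicator A (fst z, snd z + a * fst z) \<partial>lborel)"
    by (subst nn_integral_indicator[symmetric], simp, subst nn_integral_distr) auto
  also have "\<dots> = (\<integral>\<^sup>+x. \<integral>\<^sup>+y. indicator A (x, y + a * x) \<partial>lborel \<partial>lborel)"
    by (subst nn_integral_phase_snd) auto
  also have "\<dots> = (\<integral>\<^sup>+x. \<integral>\<^sup>+y. indicator A (x, y) \<partial>lborel \<partial>lborel)"
    by (intro nn_integral_cong nn_integral_shift[where f = "\<lambda>y. indicator A (_, y)"]) measurable
  also have "\<dots> = emeasure lborel A"
    by (subst nn_integral_phase_snd[symmetric]) auto
  finally show "emeasure (distr lborel borel (\<lambda>z :: phase. (fst z, snd z + a * fst z))) A = emeasure lborel A" .
qed simp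

definition rot :: "real \<Rightarrow> phase \<Rightarrow> phase" where
  "rot \<theta> z = (cos \<theta> * fst z - sin \<theta> * snd z, sin \<theta> * fst z + cos \<theta> * snd z)"

text \<open>A rotation is a product of three shears.\<close>

lemma integral_rot:
  fixes f :: "phase \<Rightarrow> complex"
  assumes \<theta>: "sin \<theta> \<noteq> 0" and f: "f \<in> borel_measurable borel"
  shows "(LINT z|lborel. f (rot \<theta> z)) = (LINT z|lborel. f z)"
proof -
  \<comment> \<open>This is \<open>- tan (\<theta> / 2)\<close>, the slope of the two outer shears
    in the factorization of a rotation.\<close>
  define a where "a = (cos \<theta> - 1) / sin \<theta>"
  define X where "X z = (fst z + a * snd z, snd z)" for z :: phase
  define Y where "Y z = (fst z, snd z + sin \<theta> * fst z)" for z :: phase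
  have [measurable]: "X \<in> borel_measurable borel" "Y \<in> borel_measurable borel"
    unfolding X_def[abs_def] Y_def[abs_def] by (rule shear_measurable)+
  have Xi: "(LINT z|lborel. g (X z)) = (LINT z|lborel. g z)"
    and Yi: "(LINT z|lborel. g (Y z)) = (LINT z|lborel. g z)" if "g \<in> borel_measurable borel" for g :: "phase \<Rightarrow> complex"
  proof -
    show "(LINT z|lborel. g (X z)) = (LINT z|lborel. g z)"
      using integral_distr[of X lborel borel g] that distr_shear_fst[of a] by (simp add: X_def[abs_def])
    show "(LINT z|lborel. g (Y z)) = (LINT z|lborel. g z)"
      using integral_distr[of Y lborel borel g] that distr_shear_snd[of "sin \<theta>"] by (simp add: Y_def[abs_def])
  qed
  have rot: "rot \<theta> z = X (Y (X z))" for z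
  proof -
    have 1: "1 + a * sin \<theta> = cos \<theta>" using \<theta> by (simp add: a_def)
    have 2: "a + a * cos \<theta> = - sin \<theta>"
    proof -
      have "(cos \<theta> - 1) * (1 + cos \<theta>) = - sin \<theta> * sin \<theta>"
        using sin_cos_squared_add[of \<theta>] by (simp add: power2_eq_square algebra_simps)
      moreover have "a + a * cos \<theta> = (cos \<theta> - 1) * (1 + cos \<theta>) / sin \<theta>"
        by (simp add: a_def distrib_left add_divide_distrib)
      ultimately show ?thesis using \<theta> by simp
    qed
    have "snd (X (Y (X z))) = sin \<theta> * fst z + (1 + a * sin \<theta>) * snd z"
      by (simp add: X_def Y_def algebra_simps)
    moreover have "fst (X (Y (X z))) = (1 + a * sin \<theta>) * fst z + (a + a * (1 + a * sin \<theta>)) * snd z"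
      by (simp add: X_def Y_def algebra_simps)
    ultimately show ?thesis unfolding 1 2 rot_def by (simp add: prod_eq_iff)
  qed
  have [measurable]: "f \<in> borel_measurable borel" by fact
  have "(LINT z|lborel. f (X (Y (X z)))) = (LINT z|lborel. f (X (Y z)))"
    by (rule Xi[of "\<lambda>z. f (X (Y z))"]) measurable
  also have "\<dots> = (LINT z|lborel. f (X z))"
    by (rule Yi[of "\<lambda>z. f (X z)"]) measurable
  also have "\<dots> = (LINT z|lborel. f z)" by (rule Xi) measurable
  finally show ?thesis unfolding rot .
qed

lemma norm_rot: "norm (rot \<theta> z) = norm z"
proof -
  have "(cos \<theta> * a - sin \<theta> * b)\<^sup>2 + (sin \<theta> * a + cos \<theta> * b)\<^sup>2 = ((sin \<theta>)\<^sup>2 + (cos \<theta>)\<^sup>2) * (a\<^sup>2 + b\<^sup>2)" for a b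
    by algebra
  then show ?thesis by (simp add: rot_def norm_prod_def)
qed

lemma zeta_rot: "zeta (rot \<theta> z) = cis \<theta> * zeta z"
  by (simp add: zeta_def rot_def complex_eq_iff)

text \<open>Cancels the phase of \<open>gauss\<close>, leaving a radial function. Being unimodular,
  it disappears from the product of one coefficient with the conjugate of another.\<close>

definition chirp :: "phase \<Rightarrow> complex" where
  "chirp z = exp (pi * \<i> * complex_of_real (fst z) * complex_of_real (snd z))"

text \<open>The coefficient has angular weight \<open>r - k\<close>. In the recurrence for
  \<open>r + 1\<close> both terms have the same weight: one factor \<open>zeta\<close> adds 1, and
  so does lowering \<open>k\<close>.\<close>

lemma chirp_hw_rot: "chirp (rot \<theta> z) * hw r k (rot \<theta> z) = cis \<theta> ^ r * cnj (cis \<theta>) ^ k * (chirp z * hw r k z)"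
proof -
  have unit: "cis \<theta> * cnj (cis \<theta>) = 1" by (simp add: cis_cnj cis_mult)
  have base: "chirp z * gauss z = exp (- (pi / 2) * (norm z)\<^sup>2)" for z
    unfolding chirp_def gauss_def by (simp add: exp_of_real[symmetric] flip: exp_add)
  have 0: "chirp (rot \<theta> z) * hw 0 k (rot \<theta> z) = cnj (cis \<theta>) ^ k * (chirp z * hw 0 k z)" for k
    unfolding hw_0 zeta_rot using base[of z] base[of "rot \<theta> z"]
    by (simp add: norm_rot power_mult_distrib mult_ac)
  have "\<forall>k. chirp (rot \<theta> z) * hw r k (rot \<theta> z) = cis \<theta> ^ r * cnj (cis \<theta>) ^ k * (chirp z * hw r k z)"
  proof (induction r)
    case (Suc r)
    show ?case
    proof
      fix k
      let ?c = "cis \<theta>" and ?h = "\<lambda>r k z. chirp z * hw r k z"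
      have low: "sqrt k * ?h r (k - 1) (rot \<theta> z) = ?c ^ Suc r * cnj ?c ^ k * (sqrt k * ?h r (k - 1) z)"
      proof (cases "k = 0")
        case False
        then obtain l where k: "k = Suc l" by (cases k) auto
        have "?c ^ Suc r * cnj ?c ^ Suc l = ?c ^ r * cnj ?c ^ l * (?c * cnj ?c)" by (simp add: mult_ac)
        then have e: "?c ^ Suc r * cnj ?c ^ Suc l = ?c ^ r * cnj ?c ^ l" using unit by simp
        show ?thesis unfolding k e diff_Suc_1 Suc.IH[rule_format] by (simp only: mult_ac)
      qed simp
      have "?h (Suc r) k (rot \<theta> z) = 1 / sqrt (Suc r) * (sqrt k * ?h r (k - 1) (rot \<theta> z) - sqrt pi * (zeta (rot \<theta> z) * ?h r k (rot \<theta> z)))"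
        unfolding hw_Suc_left by (simp add: algebra_simps del: of_nat_Suc)
      also have "\<dots> = ?c ^ Suc r * cnj ?c ^ k * (1 / sqrt (Suc r) * (sqrt k * ?h r (k - 1) z - sqrt pi * (zeta z * ?h r k z)))"
        by (subst low) (simp add: zeta_rot Suc.IH[rule_format] algebra_simps del: of_nat_Suc)
      also have "\<dots> = ?c ^ Suc r * cnj ?c ^ k * ?h (Suc r) k z"
        unfolding hw_Suc_left by (simp add: algebra_simps del: of_nat_Suc)
      finally show "?h (Suc r) k (rot \<theta> z) = ?c ^ Suc r * cnj ?c ^ k * ?h (Suc r) k z" .
    qed
  qed (use 0 in simp)
  then show ?thesis by simp
qed

text \<open>A rotation preserves the integral but multiplies it by a phase determined by the
  difference \<open>m\<close> of the two angular weights; a phase other than 1 forces the integral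
  to vanish.\<close>

lemma hw_orthogonal_radial:
  assumes S: "S \<in> sets borel" and inv: "\<And>\<theta> z. rot \<theta> z \<in> S \<longleftrightarrow> z \<in> S"
    and ne: "r + l \<noteq> s + k"
  shows "l2_inner (\<lambda>z. indicator S z * hw r k z) (hw s l) = 0"
proof -
  define m where "m = real (r + l) - real (s + k)"
  have m: "1 \<le> \<bar>m\<bar>"
  proof -
    have "m = real_of_int (int (r + l) - int (s + k))" by (simp add: m_def)
    moreover have "1 \<le> \<bar>int (r + l) - int (s + k)\<bar>" using ne by linarith
    ultimately show ?thesis by (simp only: of_int_abs[symmetric] of_int_1_le_iff)
  qed
  \<comment> \<open>Chosen so that \<open>m * \<theta>\<close> is plus or minus a right angle; since
    \<open>m\<close> has modulus at least 1, \<open>\<theta>\<close> stays below \<open>pi\<close>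
    and \<open>integral_rot\<close> applies.\<close>
  define \<theta> where "\<theta> = pi / (2 * \<bar>m\<bar>)"
  have \<theta>: "0 < \<theta>" "\<theta> < pi" using m by (auto simp: \<theta>_def field_simps)
  then have sin: "sin \<theta> \<noteq> 0" using sin_gt_zero[of \<theta>] by simp
  define c where "c = cis \<theta> ^ r * cnj (cis \<theta>) ^ k * cnj (cis \<theta> ^ s * cnj (cis \<theta>) ^ l)"
  have c: "c = cis (m * \<theta>)"
    unfolding c_def m_def complex_cnj_mult complex_cnj_power complex_cnj_cnj cis_cnj Complex.DeMoivre cis_mult
    by (rule arg_cong[of _ _ cis]) (simp add: algebra_simps)
  have "c \<noteq> 1"
  proof -
    have "m * \<theta> = pi / 2 \<or> m * \<theta> = - (pi / 2)"
      using m by (cases "0 \<le> m") (auto simp: \<theta>_def)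
    then have "cos (m * \<theta>) = 0" by (elim disjE; simp only: cos_minus cos_pi_half)
    then show ?thesis unfolding c by (simp add: complex_eq_iff)
  qed
  define g where "g z = indicator S z * hw r k z * cnj (hw s l z)" for z
  note [measurable] = S
  have gm: "g \<in> borel_measurable borel" unfolding g_def[abs_def] by measurable
  have unit: "chirp z * cnj (chirp z) = 1" for z
    unfolding mult_cnj_self by (simp add: chirp_def)
  have g: "g z = indicator S z * (chirp z * hw r k z) * cnj (chirp z * hw s l z)" for z
  proof -
    have "indicator S z * (chirp z * hw r k z) * cnj (chirp z * hw s l z) = (chirp z * cnj (chirp z)) * g z"
      by (simp add: g_def mult_ac)
    then show ?thesis by (simp add: unit)
  qed
  have "(LINT z|lborel. g z) = (LINT z|lborel. g (rot \<theta> z))"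
    by (rule integral_rot[OF sin gm, symmetric])
  also have "\<dots> = (LINT z|lborel. c * g z)"
    unfolding g chirp_hw_rot by (intro Bochner_Integration.integral_cong) (auto simp: inv indicator_def c_def)
  also have "\<dots> = c * (LINT z|lborel. g z)" by simp
  finally have "(1 - c) * (LINT z|lborel. g z) = 0" by (simp add: algebra_simps)
  then show ?thesis using \<open>c \<noteq> 1\<close> by (simp add: l2_inner_def g_def)
qed

subsection \<open>Orthonormality and concentration of the Hermite coefficients\<close>

lemma mult_zeta_hw: "sqrt pi * zeta z * hw r k z = sqrt k * hw r (k - 1) z - sqrt (Suc r) * hw (Suc r) k z"
  using hw_raise_left[of r k z] by (simp add: algebra_simps)

lemma mult_cnj_zeta_hw: "sqrt pi * cnj (zeta z) * hw r k z = sqrt (Suc k) * hw r (Suc k) z - sqrt r * hw (r - 1) k z"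
  using hw_raise_right[of k r z] by (simp add: algebra_simps)

text \<open>Multiplication by \<open>zeta\<close> is adjoint to multiplication by \<open>cnj zeta\<close>.\<close>

lemma hw_inner_rec:
  "sqrt (Suc s) * l2_inner (hw r k) (hw (Suc s) l) = sqrt l * l2_inner (hw r k) (hw s (l - 1))
     - sqrt (Suc k) * l2_inner (hw r (Suc k)) (hw s l) + sqrt r * l2_inner (hw (r - 1) k) (hw s l)"
proof -
  note sq = sq_int_cmult[OF hw_sq_int] hw_sq_int
  have "sqrt l * l2_inner (hw r k) (hw s (l - 1)) - sqrt (Suc s) * l2_inner (hw r k) (hw (Suc s) l)
      = l2_inner (hw r k) (\<lambda>z. sqrt l * hw s (l - 1) z - sqrt (Suc s) * hw (Suc s) l z)"
    by (subst l2_inner_diff_right[OF sq(1) sq(1) sq(2)]) (simp add: l2_inner_cmult_right)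
  also have "\<dots> = l2_inner (hw r k) (\<lambda>z. sqrt pi * zeta z * hw s l z)"
    unfolding mult_zeta_hw ..
  also have "\<dots> = l2_inner (\<lambda>z. sqrt pi * cnj (zeta z) * hw r k z) (hw s l)"
    unfolding l2_inner_def by (simp add: mult_ac)
  also have "\<dots> = sqrt (Suc k) * l2_inner (hw r (Suc k)) (hw s l) - sqrt r * l2_inner (hw (r - 1) k) (hw s l)"
    unfolding mult_cnj_zeta_hw
    by (subst l2_inner_diff_left[OF sq(1) sq(1) sq(2)]) (simp add: l2_inner_cmult_left)
  finally show ?thesis by (simp add: algebra_simps)
qed

text \<open>Rotations separate only different values of \<open>r - k\<close>. Pairs with equal
  weight but different windows, exactly those in the variance computation, are handled by raising
  the window index with \<open>hw_inner_rec\<close>.\<close>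

lemma hw_inner: "l2_inner (hw r k) (hw s l) = (if r = s \<and> k = l then 1 else 0)"
proof -
  have 00: "l2_inner (hw 0 k) (hw 0 l) = (if k = l then 1 else 0)" for k l
  proof (cases "k = l")
    case True
    then show ?thesis by (simp add: l2_inner_self hw_0_l2_sq)
  next
    case False
    then show ?thesis using hw_orthogonal_radial[of UNIV 0 l 0 k] by simp
  qed
  have zero: "l2_inner (hw 0 k) (hw s l) = (if 0 = s \<and> k = l then 1 else 0)" for k s l
  proof (induction s arbitrary: k l)
    case (Suc s)
    have "sqrt (Suc s) * l2_inner (hw 0 k) (hw (Suc s) l) = 0"
      unfolding hw_inner_rec Suc.IH by (cases l) auto
    then show ?case by (simp del: of_nat_Suc)
  qed (simp add: 00)
  have "\<forall>r k l. l2_inner (hw r k) (hw s l) = (if r = s \<and> k = l then 1 else 0)"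
  proof (induction s)
    case 0
    show ?case by (subst l2_inner_commute) (auto simp: zero)
  next
    case (Suc s)
    show ?case
    proof (intro allI)
      fix r k l
      have "sqrt (Suc s) * l2_inner (hw r k) (hw (Suc s) l) = complex_of_real (sqrt (Suc s)) * (if r = Suc s \<and> k = l then 1 else 0)"
        unfolding hw_inner_rec Suc.IH[rule_format] by (cases l; cases r) auto
      then show "l2_inner (hw r k) (hw (Suc s) l) = (if r = Suc s \<and> k = l then 1 else 0)"
        by (rule mult_left_cancel[OF sqrt_Suc_nonzero, THEN iffD1])
    qed
  qed
  then show ?thesis by simp
qed

lemma hw_orthonormal: "orthonormal_on UNIV (hw r)"
  by (auto simp: orthonormal_on_def hw_sq_int hw_inner)

lemma hw_l2_sq: "l2_sq (hw r k) = 1"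
  by (rule orthonormal_l2_sq[OF hw_orthonormal]) simp

text \<open>Under the probability density \<open>|hw r k|\<^sup>2\<close> the variable \<open>pi |z|\<^sup>2\<close> has mean \<open>k + r + 1\<close>; its
  variance is read off from the two neighbours produced by multiplication with \<open>pi |z|\<^sup>2\<close>.\<close>

lemma hw_deviation:
  "complex_of_real (pi * (norm z)\<^sup>2 - (real k + real r + 1)) * hw r k z
    = complex_of_real (- sqrt (real (Suc r * Suc k))) * hw (Suc r) (Suc k) z + complex_of_real (- sqrt (real (r * k))) * hw (r - 1) (k - 1) z"
proof -
  have norm: "complex_of_real (pi * (norm z)\<^sup>2) = (sqrt pi * cnj (zeta z)) * (sqrt pi * zeta z)"
  proof -
    have "complex_of_real (sqrt pi) * complex_of_real (sqrt pi) = complex_of_real pi"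
      by (simp flip: of_real_mult)
    moreover have "(sqrt pi * cnj (zeta z)) * (sqrt pi * zeta z)
        = (complex_of_real (sqrt pi) * complex_of_real (sqrt pi)) * (zeta z * cnj (zeta z))"
      by (simp only: mult_ac)
    ultimately show ?thesis unfolding mult_cnj_self norm_zeta by simp
  qed
  have r: "sqrt r * (sqrt (Suc (r - 1)) * hw (Suc (r - 1)) k z) = of_nat r * hw r k z"
    by (cases r) (simp_all del: of_nat_Suc flip: of_real_mult mult.assoc)
  have k: "sqrt (Suc k) * (sqrt (Suc k) * hw r k z) = of_nat (Suc k) * hw r k z"
    by (simp del: of_nat_Suc flip: of_real_mult mult.assoc)
  have "complex_of_real (pi * (norm z)\<^sup>2) * hw r k z = (sqrt pi * zeta z) * (sqrt pi * cnj (zeta z) * hw r k z)"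
    unfolding norm by (simp add: mult_ac)
  also have "\<dots> = sqrt (Suc k) * (sqrt pi * zeta z * hw r (Suc k) z) - sqrt r * (sqrt pi * zeta z * hw (r - 1) k z)"
    unfolding mult_cnj_zeta_hw by (simp add: algebra_simps)
  also have "\<dots> = sqrt (Suc k) * (sqrt (Suc k) * hw r k z) - sqrt (Suc k) * (sqrt (Suc r) * hw (Suc r) (Suc k) z)
      - sqrt r * (sqrt k * hw (r - 1) (k - 1) z) + sqrt r * (sqrt (Suc (r - 1)) * hw (Suc (r - 1)) k z)"
    unfolding mult_zeta_hw diff_Suc_1 by (simp add: algebra_simps del: of_nat_Suc)
  also have "\<dots> = of_nat (Suc k) * hw r k z + of_nat r * hw r k z
      - sqrt (Suc k) * (sqrt (Suc r) * hw (Suc r) (Suc k) z) - sqrt r * (sqrt k * hw (r - 1) (k - 1) z)"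
    unfolding r k by simp
  finally have eq: "complex_of_real (pi * (norm z)\<^sup>2) * hw r k z = \<dots>" .
  have s: "complex_of_real (- sqrt (real (Suc r * Suc k))) = - (sqrt (Suc r) * sqrt (Suc k))"
    "complex_of_real (- sqrt (real (r * k))) = - (sqrt r * sqrt k)"
    by (simp_all only: of_nat_mult real_sqrt_mult of_real_mult of_real_minus)
  show ?thesis unfolding s of_real_diff left_diff_distrib eq by (simp add: algebra_simps)
qed

text \<open>The two neighbours in \<open>hw_deviation\<close> are orthonormal, having windows two
  apart, so the variance is the sum of the squared coefficients. When an index is truncated at 0,
  its coefficient is 0.\<close>

lemma hw_variance:
  shows hw_variance_integrable:
      "integrable lborel (\<lambda>z. (pi * (norm z)\<^sup>2 - (real k + real r + 1))\<^sup>2 * (cmod (hw r k z))\<^sup>2)"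
    and hw_variance_eq:
      "(LINT z|lborel. (pi * (norm z)\<^sup>2 - (real k + real r + 1))\<^sup>2 * (cmod (hw r k z))\<^sup>2)
        = real (Suc r * Suc k + r * k)"
proof -
  define a b where "a = - sqrt (real (Suc r * Suc k))" and "b = - sqrt (real (r * k))"
  define F where "F z = complex_of_real a * hw (Suc r) (Suc k) z + complex_of_real b * hw (r - 1) (k - 1) z" for z
  have sq: "sq_int (\<lambda>z. c * hw r k z)" for c r k by (rule sq_int_cmult[OF hw_sq_int])
  have F: "sq_int F" unfolding F_def[abs_def] by (rule sq_int_add[OF sq sq])
  have eq: "(pi * (norm z)\<^sup>2 - (real k + real r + 1))\<^sup>2 * (cmod (hw r k z))\<^sup>2 = (cmod (F z))\<^sup>2" for z
  proof -
    have "F z = complex_of_real (pi * (norm z)\<^sup>2 - (real k + real r + 1)) * hw r k z"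
      by (simp only: F_def a_def b_def hw_deviation)
    then have "cmod (F z) = \<bar>pi * (norm z)\<^sup>2 - (real k + real r + 1)\<bar> * cmod (hw r k z)"
      by (simp only: norm_mult norm_of_real)
    then show ?thesis by (simp add: power_mult_distrib)
  qed
  show "integrable lborel (\<lambda>z. (pi * (norm z)\<^sup>2 - (real k + real r + 1))\<^sup>2 * (cmod (hw r k z))\<^sup>2)"
    unfolding eq by (rule sq_int_integrable[OF F])
  have "complex_of_real (l2_sq F) = l2_inner F F" by (simp add: l2_inner_self)
  also have "\<dots> = complex_of_real (a * a + b * b)"
  proof -
    have ne: "r - Suc 0 \<noteq> Suc r" "Suc r \<noteq> r - Suc 0" by arith+
    show ?thesis
      using F unfolding F_def[abs_def]
      by (subst l2_inner_add_left[OF sq sq], simp, subst (1 2) l2_inner_add_right[OF sq sq sq])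
         (simp add: l2_inner_cmult_left l2_inner_cmult_right hw_inner ne)
  qed
  finally have "l2_sq F = a * a + b * b" by (rule of_real_eq_iff[THEN iffD1])
  also have "\<dots> = real (Suc r * Suc k + r * k)"
    unfolding a_def b_def by (simp del: of_nat_Suc of_nat_mult)
  finally have "l2_sq F = real (Suc r * Suc k + r * k)" .
  then show "(LINT z|lborel. (pi * (norm z)\<^sup>2 - (real k + real r + 1))\<^sup>2 * (cmod (hw r k z))\<^sup>2)
        = real (Suc r * Suc k + r * k)"
    unfolding eq l2_sq_def by simp
qed

section \<open>Concentration of the coefficients on the disk of area N\<close>

definition disk :: "nat \<Rightarrow> phase set" where
  "disk N = cball 0 (sqrt (real N / pi))"

definition disk_mass :: "nat \<Rightarrow> nat \<Rightarrow> nat \<Rightarrow> real" where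
  "disk_mass r N k = (LINT z|lborel. indicator (disk N) z * (cmod (hw r k z))\<^sup>2)"

lemma disk_sets [measurable]: "disk N \<in> sets borel"
  by (simp add: disk_def)

lemma emeasure_disk: "emeasure lborel (disk N) = ennreal (real N)"
  unfolding disk_def by (subst emeasure_cball_phase) simp_all

lemma indicator_hw_sq: "indicator (disk N) z * (cmod (hw r k z))\<^sup>2 = (cmod (indicator (disk N) z * hw r k z))\<^sup>2"
  by (auto simp: indicator_def)

lemma disk_mass_integrable: "integrable lborel (\<lambda>z. indicator (disk N) z * (cmod (hw r k z))\<^sup>2)"
  unfolding indicator_hw_sq by (intro sq_int_integrable sq_int_indicator hw_sq_int disk_sets)

lemma disk_mass_nonneg: "0 \<le> disk_mass r N k"
  unfolding disk_mass_def by (intro integral_nonneg_AE) auto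

text \<open>The off-diagonal case is \<open>hw_orthogonal_radial\<close> for one common window,
  where different Hermite indices always have different angular weights.\<close>

interpretation hermite: diagonal_localization "hw r" "hermite r" "disk N" "disk_mass r N" for r N
proof
  show "orthonormal_on UNIV (hw r)" by (rule hw_orthonormal)
  show "(\<lambda>k. hw r k z * cnj (hw r k z')) sums rkernel (hermite r) z z'" for z z'
    unfolding rkernel_hermite by (rule hker_sums)
  show "rkernel (hermite r) z z = 1" for z
    by (simp add: rkernel_hermite hker_diag)
  show "disk N \<in> sets borel" by simp
  show "emeasure lborel (disk N) < \<infinity>" by (simp add: emeasure_disk)
  show "l2_inner (\<lambda>z. indicator (disk N) z * hw r k z) (hw r l) = (if k = l then complex_of_real (disk_mass r N k) else 0)" for k l
  proof (cases "k = l")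
    case True
    have "complex_of_real (disk_mass r N k) = (LINT z|lborel. complex_of_real (indicator (disk N) z * (cmod (hw r k z))\<^sup>2))"
      unfolding disk_mass_def by (rule integral_complex_of_real[symmetric])
    also have "\<dots> = l2_inner (\<lambda>z. indicator (disk N) z * hw r k z) (hw r k)"
      unfolding l2_inner_def
      by (intro Bochner_Integration.integral_cong) (auto simp: indicator_def mult_cnj_self)
    finally show ?thesis using True by simp
  next
    case False
    then show ?thesis
      by (simp add: hw_orthogonal_radial disk_def norm_rot)
  qed
qed

text \<open>Chebyshev's inequality: outside the disk \<open>pi * (norm z)\<^sup>2\<close> exceeds
  \<open>N\<close>, hence its mean by at least \<open>N - (k + r + 1)\<close>.\<close>

lemma disk_mass_tail:
  assumes "k + r + 1 < N"
  shows "(1 - disk_mass r N k) * (real N - (real k + real r + 1))\<^sup>2 \<le> real (Suc r * Suc k + r * k)"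
proof -
  let ?d = "real N - (real k + real r + 1)"
  have int: "integrable lborel (\<lambda>z. (cmod (hw r k z))\<^sup>2)" by (rule sq_int_integrable[OF hw_sq_int])
  have "(1 - disk_mass r N k) * ?d\<^sup>2 = (LINT z|lborel. ((cmod (hw r k z))\<^sup>2 - indicator (disk N) z * (cmod (hw r k z))\<^sup>2) * ?d\<^sup>2)"
    using hw_l2_sq[of r k] int disk_mass_integrable[of N r k] by (simp add: disk_mass_def l2_sq_def)
  also have "\<dots> \<le> (LINT z|lborel. (pi * (norm z)\<^sup>2 - (real k + real r + 1))\<^sup>2 * (cmod (hw r k z))\<^sup>2)"
  proof (intro integral_mono hw_variance_integrable)
    show "integrable lborel (\<lambda>z. ((cmod (hw r k z))\<^sup>2 - indicator (disk N) z * (cmod (hw r k z))\<^sup>2) * ?d\<^sup>2)"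
      using int disk_mass_integrable[of N r k] by (intro integrable_mult_left Bochner_Integration.integrable_diff)
    fix z :: phase
    show "((cmod (hw r k z))\<^sup>2 - indicator (disk N) z * (cmod (hw r k z))\<^sup>2) * ?d\<^sup>2
        \<le> (pi * (norm z)\<^sup>2 - (real k + real r + 1))\<^sup>2 * (cmod (hw r k z))\<^sup>2"
    proof (cases "z \<in> disk N")
      case False
      then have "sqrt (real N / pi) < norm z" by (simp add: disk_def)
      then have "sqrt (real N / pi) ^ 2 < (norm z)\<^sup>2" by (intro power_strict_mono) auto
      then have "real N < pi * (norm z)\<^sup>2" by (simp add: field_simps)
      then have "?d\<^sup>2 \<le> (pi * (norm z)\<^sup>2 - (real k + real r + 1))\<^sup>2"
        using assms by (intro power_mono) auto
      then show ?thesis using False by (simp add: mult.commute mult_left_mono)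
    qed simp
  qed
  finally show ?thesis by (simp only: hw_variance_eq)
qed

text \<open>The elementary bound \<open>min 1 (a\<^sup>2 / j\<^sup>2) \<le> 4 a\<^sup>2 / (a + j)\<^sup>2\<close> makes the sum telescope.\<close>

lemma telescoping_bound:
  fixes a x :: real
  assumes a: "0 < a" and j: "1 \<le> j" and x: "x \<le> 1" "x * (real j)\<^sup>2 \<le> a\<^sup>2" and x0: "0 \<le> x"
  shows "x \<le> 4 * a\<^sup>2 * (1 / (a + (real j - 1)) - 1 / (a + real j))"
proof -
  have "x * (a + real j)\<^sup>2 \<le> x * (2 * a\<^sup>2 + 2 * (real j)\<^sup>2)"
    using sum_squares_bound[of a "real j"] x0 by (intro mult_left_mono) (auto simp: power2_sum)
  also have "\<dots> = 2 * (x * a\<^sup>2) + 2 * (x * (real j)\<^sup>2)" by (simp add: algebra_simps)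
  also have "\<dots> \<le> 2 * a\<^sup>2 + 2 * a\<^sup>2"
    using x mult_right_mono[OF x(1), of "a\<^sup>2"] by (intro add_mono) auto
  finally have "x \<le> 4 * a\<^sup>2 / (a + real j)\<^sup>2" using a by (simp add: pos_le_divide_eq)
  also have "\<dots> = 4 * a\<^sup>2 * (1 / (a + real j)\<^sup>2)" by simp
  also have "\<dots> \<le> 4 * a\<^sup>2 * (1 / (a + (real j - 1)) - 1 / (a + real j))"
  proof (intro mult_left_mono)
    have "1 / (a + (real j - 1)) - 1 / (a + real j) = 1 / ((a + (real j - 1)) * (a + real j))"
      using a j by (simp add: field_simps)
    moreover have "1 / (a + real j)\<^sup>2 \<le> 1 / ((a + (real j - 1)) * (a + real j))"
      unfolding power2_eq_square using a j by (intro divide_left_mono mult_right_mono mult_pos_pos) auto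
    ultimately show "1 / (a + real j)\<^sup>2 \<le> 1 / (a + (real j - 1)) - 1 / (a + real j)" by simp
  qed simp
  finally show ?thesis .
qed

lemma disk_mass_sum_bound:
  assumes N: "1 \<le> N"
  shows "real N - (\<Sum>k<N. disk_mass r N k) \<le> real r + 1 + 4 * sqrt (real (2 * r + 1) * real N)"
proof -
  \<comment> \<open>\<open>a\<^sup>2\<close> dominates the variances for all \<open>k < N\<close>
    simultaneously, as \<open>Suc r * Suc k + r * k\<close> is at most
    \<open>(2 * r + 1) * N\<close>.\<close>
  define a where "a = sqrt (real (2 * r + 1) * real N)"
  have a: "0 < a" using N by (simp add: a_def)
  have a2: "a\<^sup>2 = real (2 * r + 1) * real N" by (simp add: a_def)
  \<comment> \<open>Counted down from the edge: for \<open>k = N - Suc m\<close> the distance from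
    the mean to \<open>N\<close> is \<open>m - r\<close>. The indices \<open>m \<le> r\<close> are
    out of Chebyshev's reach and cost at most 1 each, giving the summand
    \<open>r + 1\<close>.\<close>
  define x where "x m = 1 - disk_mass r N (N - Suc m)" for m
  have x_bound: "x m \<le> 4 * a\<^sup>2 * (1 / (a + (real (m - r) - 1)) - 1 / (a + real (m - r)))" if m: "r < m" "m < N" for m
  proof (rule telescoping_bound[OF a])
    let ?k = "N - Suc m"
    have "x m * (real (m - r))\<^sup>2 \<le> real (Suc r * Suc ?k + r * ?k)"
      using disk_mass_tail[of ?k r N] m by (simp add: x_def of_nat_diff)
    also have "\<dots> \<le> a\<^sup>2"
    proof -
      have "Suc r * Suc ?k + r * ?k \<le> Suc r * N + r * N"
        using m by (intro add_mono mult_le_mono) auto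
      also have "\<dots> = (2 * r + 1) * N" by (simp add: algebra_simps)
      finally show ?thesis unfolding a2 of_nat_mult[symmetric] of_nat_le_iff .
    qed
    finally show "x m * (real (m - r))\<^sup>2 \<le> a\<^sup>2" .
  qed (use m hermite.\<mu>_le_1 in \<open>auto simp: x_def disk_mass_nonneg\<close>)
  \<comment> \<open>The minimum counts the trivially bounded terms; the remaining ones telescope and
    contribute at most \<open>4 * a\<^sup>2 / a = 4 * a\<close>.\<close>
  have "(\<Sum>m<n. x m) \<le> real (min n (Suc r)) + 4 * a\<^sup>2 * (1 / a - 1 / (a + real (n - Suc r)))" if "n \<le> N" for n
    using that
  proof (induction n)
    case (Suc n)
    show ?case
    proof (cases "n \<le> r")
      case True
      then have "min n (Suc r) = n" "min (Suc n) (Suc r) = Suc n" "n - Suc r = 0" "Suc n - Suc r = 0"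
        by simp_all
      moreover have "x n \<le> 1" by (simp add: x_def)
      ultimately show ?thesis using Suc by simp
    next
      case False
      then have "real (n - Suc r) = real (n - r) - 1" using False by (simp add: of_nat_diff)
      moreover have "min n (Suc r) = Suc r" "min (Suc n) (Suc r) = Suc r" using False by simp_all
      ultimately show ?thesis using Suc x_bound[of n] False by (simp add: algebra_simps)
    qed
  qed simp
  from this[of N] have "(\<Sum>m<N. x m) \<le> real (min N (Suc r)) + 4 * a\<^sup>2 * (1 / a - 1 / (a + real (N - Suc r)))" by simp
  also have "\<dots> \<le> (real r + 1) + 4 * a\<^sup>2 * (1 / a)"
    using a by (intro add_mono mult_left_mono) auto
  also have "4 * a\<^sup>2 * (1 / a) = 4 * a" using a by (simp add: power2_eq_square)
  also have "(\<Sum>m<N. x m) = (\<Sum>k<N. 1 - disk_mass r N k)"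
    unfolding x_def by (rule sum.nat_diff_reindex)
  finally show ?thesis by (simp add: sum_subtractf a_def)
qed

theorem theorem5p4:
  fixes r :: nat
  shows "\<exists>C C'::real. \<forall>N::nat. \<forall>(lam :: nat \<Rightarrow> real) (p :: nat \<Rightarrow> phase \<Rightarrow> complex).
     eigensystem (loc_kernel (hermite r) (cball 0 (sqrt (real N / pi)))) lam p \<longrightarrow>
     trace_norm (\<lambda>z z'. fwh_kernel (cball 0 (sqrt (real N / pi))) p z z'
        - (\<Sum>j<N. stft (hermite r) (hermite j) z * cnj (stft (hermite r) (hermite j) z')))
       \<le> ereal (C * (2 * pi * sqrt (real N / pi)))
     \<and> C * (2 * pi * sqrt (real N / pi)) \<le> C' * sqrt (real N)"
proof -
  \<comment> \<open>The 4 comes from \<open>trace_norm_fwh_le\<close>; the bracket is the bound of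
    \<open>disk_mass_sum_bound\<close> after its constant part is absorbed by
    \<open>1 \<le> sqrt N\<close> for nonzero \<open>N\<close>.\<close>
  define c where "c = 4 * (real r + 1 + 4 * sqrt (real (2 * r + 1)))"
  \<comment> \<open>The perimeter equals \<open>2 * sqrt pi * sqrt N\<close>, so the witnesses are
    \<open>c / (2 * sqrt pi)\<close> and \<open>c\<close>.\<close>
  have perimeter: "c / (2 * sqrt pi) * (2 * pi * sqrt (real N / pi)) = c * sqrt (real N)" for N
  proof -
    have "c / (2 * sqrt pi) * (2 * pi * sqrt (real N / pi)) = c * sqrt (real N) * (pi / (sqrt pi * sqrt pi))"
      by (simp add: real_sqrt_divide)
    then show ?thesis by simp
  qed
  have bound: "4 * (real N - (\<Sum>k<N. disk_mass r N k)) \<le> c * sqrt (real N)" for N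
  proof (cases "N = 0")
    case False
    then have N: "1 \<le> N" by simp
    have "real N - (\<Sum>k<N. disk_mass r N k) \<le> (real r + 1) * 1 + 4 * sqrt (real (2 * r + 1)) * sqrt (real N)"
      using disk_mass_sum_bound[OF N, of r] by (simp add: real_sqrt_mult)
    also have "\<dots> \<le> (real r + 1) * sqrt (real N) + 4 * sqrt (real (2 * r + 1)) * sqrt (real N)"
      using N by (intro add_right_mono mult_left_mono) auto
    finally show ?thesis by (simp add: c_def algebra_simps)
  qed simp
  have "trace_norm (\<lambda>z z'. fwh_kernel (disk N) p z z'
        - (\<Sum>j<N. stft (hermite r) (hermite j) z * cnj (stft (hermite r) (hermite j) z')))
       \<le> ereal (c / (2 * sqrt pi) * (2 * pi * sqrt (real N / pi)))"
    if "eigensystem (loc_kernel (hermite r) (disk N)) lam p" for N lam p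
  proof -
    have "measure lborel (disk N) = real N" by (simp add: measure_def emeasure_disk)
    from hermite.trace_norm_fwh_le[OF that this] bound[of N] show ?thesis
      unfolding perimeter stft_hermite hw_def[symmetric] by (meson ereal_less_eq(3) order_trans)
  qed
  note trace_bound = this[unfolded disk_def]
  show ?thesis
  proof (rule exI[of _ "c / (2 * sqrt pi)"], rule exI[of _ c], intro allI impI conjI)
    show "c / (2 * sqrt pi) * (2 * pi * sqrt (real N / pi)) \<le> c * sqrt (real N)" for N
      by (simp only: perimeter)
  qed (rule trace_bound)
qed

end
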